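(* (1) The structure of recursive subsets of $\omega$ under inclusion can be embedded into $\mathrm{Deg}_{\Pi^0_1}(\mathsf{Comp})$; that is, there is a map $\psi_0$ from the recursive subsets of $\omega$ to the $\Pi^0_1$ subsets of $\omega^\omega$ such that for all recursive $X,Y\subseteq\omega$: $X\subseteq Y \iff \psi_0(X)\leq_{\mathsf{Comp}}\psi_0(Y)$. (2) The structure of recursively enumerable subsets of $\omega$ under inclusion can be embedded into $\mathrm{Deg}_{\Sigma^0_2}(\mathsf{Comp})$; that is, there is a map $\psi_1$ from the recursively enumerable subsets of $\omega$ to the $\Sigma^0_2$ subsets of $\omega^\omega$ such that for all recursively enumerable $X,Y\subseteq\omega$: $X\subseteq Y \iff \psi_1(X)\leq_{\mathsf{Comp}}\psi_1(Y)$.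
   Context: Base theory: $\mathsf{ZF}+\mathsf{DC}(\mathbb{R})$. $\omega^\omega$ is the Baire space (infinite sequences of natural numbers), $\omega^{<\omega}$ the set of finite sequences of naturals, $\mathrm{lh}(s)$ the length of $s$, and $\subseteq$ between sequences means "is an initial segment of". A function $f:\omega^\omega\to\omega^\omega$ is computable if it has a computable approximating function, i.e. a function $\varphi:\omega^{<\omega}\to\omega^{<\omega}$ which is computable (via the standard Gödel coding bijection $\omega^{<\omega}\to\omega$) and satisfies: (a) $s\subseteq t\Rightarrow\varphi(s)\subseteq\varphi(t)$; (b) $\lim_{n\to\infty}\mathrm{lh}(\varphi(x\restriction n))=\infty$ for all $x\in\omega^\omega$; (c) $f(x)=\bigcup_n\varphi(x\restriction n)$ for all $x\in\omega^\omega$. $\mathsf{Comp}$ is the set of all computable functions $\omega^\omega\to\omega^\omega$. For $A,B\subseteq\omega^\omega$, $A\leq_{\mathsf{Comp}}B$ iff $A=f^{-1}(B)$ for some $f\in\mathsf{Comp}$. This is a preorder; its equivalence classes (for $A\equiv_{\mathsf{Comp}}B\iff A\leq_{\mathsf{Comp}}B\leq_{\mathsf{Comp}}A$) are the $\mathsf{Comp}$-degrees, partially ordered by the induced order. For $\Gamma$ a collection of subsets of $\omega^\omega$ closed under $\equiv_{\mathsf{Comp}}$, $\mathrm{Deg}_\Gamma(\mathsf{Comp})$ is the partial order of $\mathsf{Comp}$-degrees of sets in $\Gamma$. $\Pi^0_1$ and $\Sigma^0_2$ are the (lightface) Kleene pointclasses of subsets of $\omega^\omega$. *)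

theory Defs
  imports Main "HOL-Library.Nat_Bijection" "HOL-Library.Sublist"
begin

section \<open>Recursive functions on the natural numbers\<close>

text \<open>
  Kleene's \<open>\<mu>\<close>-recursive function schemes. Arities are not recorded in the syntax: a scheme is
  evaluated on an argument list and is undefined on lists of an unsuitable length.
  In primitive recursion and minimisation the distinguished variable is the first argument.
\<close>

datatype scheme =
    Zero
  | Succ
  | Proj nat
  | Compose scheme "scheme list"
  | Prec scheme scheme
  | Mu scheme

inductive computes :: "scheme \<Rightarrow> nat list \<Rightarrow> nat \<Rightarrow> bool" where
  Zero: "computes Zero xs 0"
| Succ: "computes Succ [x] (Suc x)"
| Proj: "i < length xs \<Longrightarrow> computes (Proj i) xs (xs ! i)"
| Compose: "\<lbrakk>list_all2 (\<lambda>g y. computes g xs y) gs ys; computes f ys z\<rbrakk>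
    \<Longrightarrow> computes (Compose f gs) xs z"
| Prec_0: "computes f xs y \<Longrightarrow> computes (Prec f g) (0 # xs) y"
| Prec_Suc: "\<lbrakk>computes (Prec f g) (n # xs) r; computes g (n # r # xs) y\<rbrakk>
    \<Longrightarrow> computes (Prec f g) (Suc n # xs) y"
| Mu: "\<lbrakk>computes f (n # xs) 0; \<forall>i<n. \<exists>y. computes f (i # xs) (Suc y)\<rbrakk>
    \<Longrightarrow> computes (Mu f) xs n"

lemma computes_deterministic:
  "computes p xs y \<Longrightarrow> computes p xs z \<Longrightarrow> y = z"
proof (induction arbitrary: z rule: computes.induct)
  case (Zero xs)
  then show ?case by cases auto
next
  case (Succ x)
  then show ?case by cases auto
next
  case (Proj i xs)
  from Proj(2) show ?case by cases auto
next
  case (Compose xs gs ys f y)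
  from Compose.prems obtain ys' where
    ys': "list_all2 (\<lambda>g y. computes g xs y) gs ys'" "computes f ys' z"
    by cases auto
  have "ys = ys'"
    using Compose.IH(1) ys'(1)
    by (auto simp: list_all2_conv_all_nth intro: nth_equalityI)
  then show ?case using Compose.IH(2) ys'(2) by blast
next
  case (Prec_0 f xs y g)
  from Prec_0.prems show ?case using Prec_0.IH by cases auto
next
  case (Prec_Suc f g n xs r y)
  from Prec_Suc.prems show ?case using Prec_Suc.IH by cases auto
next
  case (Mu f n xs)
  from Mu.prems have z: "computes f (z # xs) 0" "\<forall>i<z. \<exists>y. computes f (i # xs) (Suc y)"
    by (cases, simp)+
  have "\<not> z < n" using Mu.IH(2) z(1) by fastforce
  moreover have "\<not> n < z" using Mu.IH(1) z(2) by fastforce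
  ultimately show ?case by simp
qed

definition recursive_function :: "(nat \<Rightarrow> nat) \<Rightarrow> bool" where
  "recursive_function h \<longleftrightarrow> (\<exists>p. \<forall>n y. computes p [n] y \<longleftrightarrow> y = h n)"

definition recursive_sets :: "nat set set" where
  "recursive_sets = {X. recursive_function (\<lambda>n. if n \<in> X then 1 else 0)}"

text \<open>Domains of unary partial recursive functions.\<close>

definition re_sets :: "nat set set" where
  "re_sets = {X. \<exists>p. X = {n. \<exists>y. computes p [n] y}}"


section \<open>Computable functions on Baire space\<close>

type_synonym baire = "nat \<Rightarrow> nat"

definition restr :: "baire \<Rightarrow> nat \<Rightarrow> nat list" where
  "restr x n = map x [0..<n]"

definition computable_on_strings :: "(nat list \<Rightarrow> nat list) \<Rightarrow> bool" where
  "computable_on_strings \<phi> \<longleftrightarrow> recursive_function (\<lambda>n. list_encode (\<phi> (list_decode n)))"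

text \<open>
  The last conjunct says that the graph of the sequence \<open>f x\<close> is the union of the graphs of
  the finite sequences \<open>\<phi> (restr x n)\<close>.
\<close>

definition approximates :: "(nat list \<Rightarrow> nat list) \<Rightarrow> (baire \<Rightarrow> baire) \<Rightarrow> bool" where
  "approximates \<phi> f \<longleftrightarrow>
     (\<forall>s t. prefix s t \<longrightarrow> prefix (\<phi> s) (\<phi> t)) \<and>
     (\<forall>x. filterlim (\<lambda>n. length (\<phi> (restr x n))) at_top sequentially) \<and>
     (\<forall>x. {(i, f x i) | i. True} =
        (\<Union>n. {(i, \<phi> (restr x n) ! i) | i. i < length (\<phi> (restr x n))}))"

definition Comp :: "(baire \<Rightarrow> baire) set" where
  "Comp = {f. \<exists>\<phi>. computable_on_strings \<phi> \<and> approximates \<phi> f}"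


section \<open>Reducibility and degrees\<close>

definition comp_le :: "baire set \<Rightarrow> baire set \<Rightarrow> bool"  (infix \<open>\<le>\<^sub>C\<close> 50) where
  "A \<le>\<^sub>C B \<longleftrightarrow> (\<exists>f\<in>Comp. A = f -` B)"

definition comp_equiv :: "baire set \<Rightarrow> baire set \<Rightarrow> bool"  (infix \<open>\<equiv>\<^sub>C\<close> 50) where
  "A \<equiv>\<^sub>C B \<longleftrightarrow> A \<le>\<^sub>C B \<and> B \<le>\<^sub>C A"

definition comp_degree :: "baire set \<Rightarrow> baire set set" where
  "comp_degree A = {B. A \<equiv>\<^sub>C B}"

definition Deg :: "baire set set \<Rightarrow> baire set set set" where
  "Deg \<Gamma> = comp_degree ` \<Gamma>"

definition degree_le :: "baire set set \<Rightarrow> baire set set \<Rightarrow> bool" where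
  "degree_le a b \<longleftrightarrow> (\<exists>A\<in>a. \<exists>B\<in>b. A \<le>\<^sub>C B)"

definition order_embedding ::
  "('a \<Rightarrow> 'b) \<Rightarrow> 'a set \<Rightarrow> ('a \<Rightarrow> 'a \<Rightarrow> bool) \<Rightarrow> 'b set \<Rightarrow> ('b \<Rightarrow> 'b \<Rightarrow> bool) \<Rightarrow> bool" where
  "order_embedding h P leP Q leQ \<longleftrightarrow>
     h ` P \<subseteq> Q \<and> inj_on h P \<and> (\<forall>x\<in>P. \<forall>y\<in>P. leP x y \<longleftrightarrow> leQ (h x) (h y))"


section \<open>Lightface pointclasses\<close>

definition cylinder :: "nat list \<Rightarrow> baire set" where
  "cylinder s = {x. restr x (length s) = s}"

text \<open>
  Lightface \<open>\<Sigma>\<^sup>0\<^sub>1\<close> means a recursively enumerable union of basic open sets, in the Baire space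
  and in its product with the discrete space of natural numbers respectively. The product is
  needed because a \<open>\<Sigma>\<^sup>0\<^sub>2\<close> set is the projection along the natural numbers of a lightface
  \<open>\<Pi>\<^sup>0\<^sub>1\<close> subset of it.
\<close>

definition Sigma01 :: "baire set set" where
  "Sigma01 = {A. \<exists>W. list_encode ` W \<in> re_sets \<and> A = (\<Union>s\<in>W. cylinder s)}"

definition Pi01 :: "baire set set" where
  "Pi01 = {A. - A \<in> Sigma01}"

definition Sigma01_prod :: "(nat \<times> baire) set set" where
  "Sigma01_prod = {P. \<exists>W. (\<lambda>(m, s). prod_encode (m, list_encode s)) ` W \<in> re_sets \<and>
                          P = (\<Union>(m, s)\<in>W. {m} \<times> cylinder s)}"

definition Pi01_prod :: "(nat \<times> baire) set set" where
  "Pi01_prod = {P. - P \<in> Sigma01_prod}"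

definition Sigma02 :: "baire set set" where
  "Sigma02 = {A. \<exists>P\<in>Pi01_prod. A = {x. \<exists>m. (m, x) \<in> P}}"

end

(*
  Membership of x in psi(X) requires that x 0 avoids an r.e. set D and that the column of x 0
  belongs to X. For r.e. X the sequence x must moreover be nonzero somewhere after position 0, so
  that a reduction can output zeros until the column of x 0 has been enumerated into X.

  If n lies in X but not in Y, a reduction of psi(X) to psi(Y), applied to the sequences
  w 1 1 1 ... with w in column n, yields an r.e. relation W such that W(w, v) implies v ~= w and
  (w in D iff v in D), and such that every w outside D is related to some v. D is built to exclude
  this. Requirement i = (n, e) owns infinitely many witnesses in column n and enumerates at most one
  of them, w, into D, on one of two grounds:
    - W_e(w, v) and W_e(w', v) for another witness w' of requirement i, which stays outside D;
    - W_e(w, v), where v is not yet in D and lies on the 2i-th diagonal of the pairing or beyond;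
      then v is kept out of D forever.
  There is no injury: the bound on v leaves every requirement infinitely many witnesses that no
  other requirement protects. If requirement i never acts, W_e maps these witnesses injectively
  (first ground) into the finitely many numbers below the 2i-th diagonal (second ground).
*)
theory Submission
  imports Defs
begin

section \<open>Primitive recursion and pairing\<close>

inductive_cases computes_MuE: "computes (Mu f) xs y"

text \<open>Schemes carry no arity, so a scheme has to agree with \<open>F\<close> only on lists of
  length \<open>k\<close>; uniqueness of the value comes from
  \<open>computes_deterministic\<close>.\<close>

definition nary :: "nat \<Rightarrow> (nat list \<Rightarrow> nat) \<Rightarrow> bool" where
  "nary k F \<longleftrightarrow> (\<exists>p. \<forall>xs. length xs = k \<longrightarrow> computes p xs (F xs))"

lemma nary_cong: "nary k F \<Longrightarrow> (\<And>xs. length xs = k \<Longrightarrow> F xs = G xs) \<Longrightarrow> nary k G"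
  unfolding nary_def by auto

lemma nary_zero: "nary k (\<lambda>xs. 0)"
  unfolding nary_def by (auto intro: computes.Zero)

lemma nary_proj: "i < k \<Longrightarrow> nary k (\<lambda>xs. xs ! i)"
  unfolding nary_def by (auto intro: computes.Proj)

lemma nary_compose:
  assumes "nary (length Gs) F" "\<And>G. G \<in> set Gs \<Longrightarrow> nary k G"
  shows "nary k (\<lambda>xs. F (map (\<lambda>G. G xs) Gs))"
proof -
  from assms(1) obtain p where p: "\<And>xs. length xs = length Gs \<Longrightarrow> computes p xs (F xs)"
    unfolding nary_def by auto
  from assms(2) have "\<forall>G\<in>set Gs. \<exists>q. \<forall>xs. length xs = k \<longrightarrow> computes q xs (G xs)"
    unfolding nary_def by auto
  then obtain q where q: "\<And>G xs. G \<in> set Gs \<Longrightarrow> length xs = k \<Longrightarrow> computes (q G) xs (G xs)"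
    by metis
  have "computes (Compose p (map q Gs)) xs (F (map (\<lambda>G. G xs) Gs))" if "length xs = k" for xs
    by (rule computes.Compose[OF _ p]) (auto simp: list_all2_conv_all_nth q that)
  then show ?thesis unfolding nary_def by blast
qed

lemma nary_suc: "nary k a \<Longrightarrow> nary k (\<lambda>xs. Suc (a xs))"
proof -
  assume a: "nary k a"
  have "nary (length [a]) (\<lambda>xs. Suc (xs ! 0))"
    unfolding nary_def by (auto simp: length_Suc_conv intro!: exI[of _ Succ] computes.Succ)
  from nary_compose[OF this, of k] a show ?thesis by simp
qed

text \<open>Lets a parameter function be used inside the step of a recursion, where the counter and
  the previous value precede the parameters.\<close>

lemma nary_drop2:
  assumes "nary k a" shows "nary (Suc (Suc k)) (\<lambda>ys. a (drop 2 ys))"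
proof -
  have "nary (length (map (\<lambda>i xs. xs ! (i + 2)) [0..<k])) a" using assms by simp
  moreover have "nary (Suc (Suc k)) G" if "G \<in> set (map (\<lambda>i xs. xs ! (i + 2)) [0..<k])" for G
    using that by (auto intro: nary_proj)
  ultimately have "nary (Suc (Suc k)) (\<lambda>xs. a (map (\<lambda>G. G xs) (map (\<lambda>i xs. xs ! (i + 2)) [0..<k])))"
    by (rule nary_compose)
  then have "nary (Suc (Suc k)) (\<lambda>xs. a (map (\<lambda>i. xs ! (i + 2)) [0..<k]))"
    by (simp add: comp_def)
  then show ?thesis
    by (rule nary_cong) (auto intro!: arg_cong[of _ _ a] nth_equalityI)
qed

text \<open>\<open>Prec\<close> recurses on its first argument; composing it with \<open>c\<close>
  followed by the projections puts \<open>c xs\<close> there and leaves the parameters in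
  place.\<close>

lemma nary_rec:
  assumes a: "nary k a" and g: "nary (Suc (Suc k)) (\<lambda>ys. g (ys ! 0) (ys ! 1) (drop 2 ys))"
    and c: "nary k c"
  shows "nary k (\<lambda>xs. rec_nat (a xs) (\<lambda>n r. g n r xs) (c xs))"
proof -
  from a obtain p where p: "\<And>xs. length xs = k \<Longrightarrow> computes p xs (a xs)"
    unfolding nary_def by auto
  from g obtain q where
    q: "\<And>ys. length ys = Suc (Suc k) \<Longrightarrow> computes q ys (g (ys ! 0) (ys ! 1) (drop 2 ys))"
    unfolding nary_def by auto
  have *: "computes (Prec p q) (n # xs) (rec_nat (a xs) (\<lambda>n r. g n r xs) n)"
    if "length xs = k" for n xs
  proof (induction n)
    case 0
    then show ?case using p[OF that] by (auto intro: computes.Prec_0)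
  next
    case (Suc n)
    show ?case using computes.Prec_Suc[OF Suc] q[of "n # _ # xs"] that by auto
  qed
  have 1: "nary (length (c # map (\<lambda>i xs. xs ! i) [0..<k]))
      (\<lambda>ys. rec_nat (a (tl ys)) (\<lambda>n r. g n r (tl ys)) (hd ys))"
    unfolding nary_def
    by (rule exI[of _ "Prec p q"]) (auto simp: length_Suc_conv intro!: *)
  have "nary k G" if "G \<in> set (c # map (\<lambda>i xs. xs ! i) [0..<k])" for G
    using that c by (auto intro: nary_proj)
  from nary_compose[OF 1 this]
  have "nary k (\<lambda>xs. rec_nat (a (map (\<lambda>i. xs ! i) [0..<k]))
      (\<lambda>n r. g n r (map (\<lambda>i. xs ! i) [0..<k])) (c xs))"
    by (simp add: comp_def)
  moreover have "map (\<lambda>i. xs ! i) [0..<k] = xs" if "length xs = k" for xs :: "nat list"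
    using that by (metis map_nth)
  ultimately show ?thesis by (elim nary_cong) simp
qed

lemma nary_plus:
  assumes "nary k a" "nary k b" shows "nary k (\<lambda>xs. a xs + b xs)"
proof -
  have "rec_nat x (\<lambda>n r. Suc r) y = x + y" for x y by (induction y) auto
  moreover have "nary k (\<lambda>xs. rec_nat (a xs) (\<lambda>n r. Suc r) (b xs))"
    by (intro nary_rec assms nary_suc nary_proj) auto
  ultimately show ?thesis by simp
qed

lemma nary_diff:
  assumes "nary k a" "nary k b" shows "nary k (\<lambda>xs. a xs - b xs)"
proof -
  have p: "nary l (\<lambda>xs. c xs - 1)" if "nary l c" for l c
  proof -
    have "rec_nat 0 (\<lambda>n r. n) x = x - 1" for x by (cases x) auto
    moreover have "nary l (\<lambda>xs. rec_nat 0 (\<lambda>n r. n) (c xs))"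
      by (intro nary_rec that nary_zero nary_proj) auto
    ultimately show ?thesis by simp
  qed
  have "rec_nat x (\<lambda>n r. r - 1) y = x - y" for x y by (induction y) auto
  moreover have "nary k (\<lambda>xs. rec_nat (a xs) (\<lambda>n r. r - 1) (b xs))"
    by (intro nary_rec assms p nary_proj) auto
  ultimately show ?thesis by simp
qed

lemma nary_if_zero:
  assumes "nary k c" "nary k a" "nary k b"
  shows "nary k (\<lambda>xs. if c xs = 0 then a xs else b xs)"
proof -
  have "rec_nat x (\<lambda>n r. y) z = (if z = 0 then x else y)" for x y z :: nat by (cases z) auto
  moreover have "nary k (\<lambda>xs. rec_nat (a xs) (\<lambda>n r. b xs) (c xs))"
    by (intro nary_rec nary_drop2 assms)
  ultimately show ?thesis by simp
qed

section \<open>Triangular numbers and Cantor's pairing function\<close>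

lemma nary_triangle:
  assumes "nary k a" shows "nary k (\<lambda>xs. triangle (a xs))"
proof -
  have "rec_nat 0 (\<lambda>n r. r + Suc n) x = triangle x" for x by (induction x) auto
  moreover have "nary k (\<lambda>xs. rec_nat 0 (\<lambda>n r. r + Suc n) (a xs))"
    by (intro nary_rec assms nary_plus nary_suc nary_zero nary_proj) auto
  ultimately show ?thesis by simp
qed

lemma nary_prod_encode:
  "nary k a \<Longrightarrow> nary k b \<Longrightarrow> nary k (\<lambda>xs. prod_encode (a xs, b xs))"
  unfolding prod_encode_def split by (intro nary_plus nary_triangle)

text \<open>The diagonal \<open>m + n\<close> on which the pair with code \<open>z\<close> lies.\<close>

definition diag :: "nat \<Rightarrow> nat" where
  "diag = rec_nat 0 (\<lambda>z d. if triangle (Suc d) - Suc z = 0 then Suc d else d)"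

text \<open>The truncated subtraction in \<open>diag\<close> vanishes iff triangle (Suc d) \<le> Suc
  z, that is, when \<open>Suc z\<close> opens the next diagonal.\<close>

lemma diag_bounds: "triangle (diag z) \<le> z \<and> z < triangle (Suc (diag z))"
  by (induction z) (auto simp: diag_def)

text \<open>A closed form of the inverse pairing in operations that are primitive recursive.\<close>

lemma prod_decode_diag: "prod_decode z = (z - triangle (diag z), diag z - (z - triangle (diag z)))"
proof -
  have "z - triangle (diag z) \<le> diag z" using diag_bounds[of z] by (simp del: One_nat_def) linarith
  then have "prod_encode (z - triangle (diag z), diag z - (z - triangle (diag z))) = z"
    using diag_bounds[of z] by (simp add: prod_encode_def)
  then show ?thesis by (metis prod_encode_inverse)
qed

lemma nary_diag: "nary k a \<Longrightarrow> nary k (\<lambda>xs. diag (a xs))"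
  unfolding diag_def
  by (intro nary_rec nary_if_zero nary_diff nary_triangle nary_suc nary_zero nary_proj) auto

lemma nary_fst: "nary k a \<Longrightarrow> nary k (\<lambda>xs. fst (prod_decode (a xs)))"
  and nary_snd: "nary k a \<Longrightarrow> nary k (\<lambda>xs. snd (prod_decode (a xs)))"
  unfolding prod_decode_diag fst_conv snd_conv
  by (intro nary_diff nary_diag nary_triangle; assumption)+

lemma recursive_function_nary: "recursive_function h \<longleftrightarrow> nary 1 (\<lambda>xs. h (xs ! 0))"
proof
  assume "recursive_function h"
  then obtain p where "\<forall>n y. computes p [n] y \<longleftrightarrow> y = h n"
    unfolding recursive_function_def by auto
  then show "nary 1 (\<lambda>xs. h (xs ! 0))"
    unfolding nary_def by (intro exI[of _ p]) (auto simp: length_Suc_conv)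
next
  assume "nary 1 (\<lambda>xs. h (xs ! 0))"
  then obtain p where p: "\<And>xs. length xs = 1 \<Longrightarrow> computes p xs (h (xs ! 0))"
    unfolding nary_def by auto
  have "computes p [n] (h n)" for n using p[of "[n]"] by simp
  then show "recursive_function h"
    unfolding recursive_function_def using computes_deterministic by blast
qed

lemma nary_recursive_function:
  assumes "recursive_function h" "nary k a" shows "nary k (\<lambda>xs. h (a xs))"
  using nary_compose[of "[a]" "\<lambda>xs. h (xs ! 0)" k] assms
  by (simp add: recursive_function_nary)

lemma recursive_function_id: "recursive_function (\<lambda>n. n)"
  unfolding recursive_function_nary by (rule nary_proj) simp

lemma recursive_function_compose:
  "recursive_function h \<Longrightarrow> recursive_function g \<Longrightarrow> recursive_function (\<lambda>n. h (g n))"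
  unfolding recursive_function_nary[of g] recursive_function_nary[of "\<lambda>n. h (g n)"]
  by (rule nary_recursive_function)

lemma recursive_function_const: "recursive_function (\<lambda>n. c)"
  unfolding recursive_function_nary by (induction c) (auto intro: nary_zero nary_suc)

lemma recursive_function_Suc: "recursive_function Suc"
  unfolding recursive_function_nary by (intro nary_suc nary_proj) simp

lemma recursive_function_pair:
  "recursive_function g \<Longrightarrow> recursive_function h \<Longrightarrow> recursive_function (\<lambda>n. prod_encode (g n, h n))"
  unfolding recursive_function_nary by (rule nary_prod_encode)

lemma recursive_function_fst: "recursive_function (\<lambda>n. fst (prod_decode n))"
  and recursive_function_snd: "recursive_function (\<lambda>n. snd (prod_decode n))"
  unfolding recursive_function_nary by (intro nary_fst nary_snd nary_proj; simp)+

lemma recursive_function_rec: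
  assumes "recursive_function a" "recursive_function g" "recursive_function c"
  shows "recursive_function
    (\<lambda>x. rec_nat (a x) (\<lambda>n r. g (prod_encode (n, prod_encode (r, x)))) (c x))"
  unfolding recursive_function_nary
  by (intro nary_rec[where g="\<lambda>n r xs. g (prod_encode (n, prod_encode (r, xs ! 0)))"]
      nary_recursive_function[OF assms(1)] nary_recursive_function[OF assms(2)]
      nary_recursive_function[OF assms(3)] nary_prod_encode nary_proj nary_drop2) auto

section \<open>Computable functions and decidable predicates on coded types\<close>

text \<open>Codes are bijective, so every number decodes and computability can be defined without a
  test for ill-formed codes.\<close>

class coded =
  fixes code :: "'a \<Rightarrow> nat"
  assumes bij_code: "bij code"

definition decode :: "nat \<Rightarrow> 'a::coded" where
  "decode = inv code"

lemma decode_code [simp]: "decode (code x) = x"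
  unfolding decode_def by (rule inv_f_f[OF bij_is_inj[OF bij_code]])

lemma code_decode [simp]: "code (decode n :: 'a::coded) = n"
  unfolding decode_def by (rule surj_f_inv_f[OF bij_is_surj[OF bij_code]])

lemma code_eq_iff [simp]: "code x = code y \<longleftrightarrow> x = y"
  by (metis decode_code)

instantiation nat :: coded
begin
definition code_nat :: "nat \<Rightarrow> nat" where [simp]: "code_nat n = n"
instance by standard (simp add: code_nat_def[abs_def] bij_id[unfolded id_def])
end

instantiation prod :: (coded, coded) coded
begin
definition code_prod :: "'a \<times> 'b \<Rightarrow> nat" where
  "code_prod p = prod_encode (code (fst p), code (snd p))"
instance
proof (standard, rule o_bij)
  let ?g = "\<lambda>n. map_prod decode decode (prod_decode n) :: 'a \<times> 'b"
  show "?g \<circ> code = id" by (auto simp: code_prod_def)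
  show "code \<circ> ?g = id" by (auto simp: code_prod_def map_prod_def split_beta)
qed
end

instantiation list :: (coded) coded
begin
definition code_list :: "'a list \<Rightarrow> nat" where
  "code_list xs = list_encode (map code xs)"
instance
proof (standard, rule o_bij)
  let ?g = "\<lambda>n. map decode (list_decode n) :: 'a list"
  show "?g \<circ> code = id" by (auto simp: code_list_def comp_def)
  show "code \<circ> ?g = id" by (auto simp: code_list_def comp_def)
qed
end

lemma decode_nat [simp]: "decode n = (n :: nat)"
  using code_decode[of n, where 'a = nat] by (simp only: code_nat_def)

lemma code_pair [simp]: "code (a, b) = prod_encode (code a, code b)"
  by (simp add: code_prod_def)

lemma decode_pair: "decode n = (decode (fst (prod_decode n)), decode (snd (prod_decode n)))"
  by (subst code_eq_iff[symmetric]) simp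

lemma code_Nil: "code [] = 0"
  and code_Cons: "code (x # xs) = Suc (code (x, xs))"
  by (simp_all add: code_list_def)

lemma code_nat_list: "code = list_encode"
  by (auto simp: code_list_def code_nat_def[abs_def])

lemma decode_nat_list: "decode = list_decode"
proof (rule ext)
  fix n
  have "code (decode n :: nat list) = list_encode (list_decode n)" by simp
  then show "decode n = list_decode n" unfolding code_nat_list list_encode_eq .
qed

text \<open>Supplies the number of iterations for \<open>computable_fold\<close>, before the length
  itself is known to be computable.\<close>

lemma length_le_code: "length xs \<le> code xs"
proof (induction xs)
  case (Cons x xs)
  then show ?case
    using le_prod_encode_2[of "code xs" "code x"] by (simp add: code_Cons)
qed simp

definition computable :: "('a::coded \<Rightarrow> 'b::coded) \<Rightarrow> bool" where
  "computable f \<longleftrightarrow> recursive_function (\<lambda>n. code (f (decode n)))"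

lemma computableI:
  assumes "recursive_function h" "\<And>x. code (f x) = h (code x)"
  shows "computable f"
  using assms unfolding computable_def by simp

lemma computable_on_strings_iff: "computable_on_strings \<phi> \<longleftrightarrow> computable \<phi>"
  unfolding computable_on_strings_def computable_def code_nat_list decode_nat_list ..

lemma computable_nat_iff: "computable h \<longleftrightarrow> recursive_function h" for h :: "nat \<Rightarrow> nat"
  unfolding computable_def by simp

section \<open>Closure properties of computable functions\<close>

named_theorems computable_intros

lemma computable_const [computable_intros]: "computable (\<lambda>x. c)"
  unfolding computable_def by (rule recursive_function_const)

lemma computable_id [computable_intros]: "computable (\<lambda>x. x)"
  unfolding computable_def by (simp add: recursive_function_id)

lemma computable_compose:
  assumes "computable f" "computable g" shows "computable (\<lambda>x. f (g x))"
  using recursive_function_compose[OF assms[unfolded computable_def]]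
  unfolding computable_def by simp

lemma computable_code [computable_intros]:
  assumes "computable f" shows "computable (\<lambda>x. code (f x))"
  using assms unfolding computable_def by simp

lemma computable_decode [computable_intros]:
  assumes "computable f" shows "computable (\<lambda>x. decode (f x))"
  using assms unfolding computable_def by simp

lemma computable_Pair [computable_intros]:
  "computable f \<Longrightarrow> computable g \<Longrightarrow> computable (\<lambda>x. (f x, g x))"
  unfolding computable_def by (simp add: recursive_function_pair)

lemma computable_fst [computable_intros]:
  "computable f \<Longrightarrow> computable (\<lambda>x. fst (f x))"
  by (rule computable_compose[of fst, OF computableI[OF recursive_function_fst]])
    (auto simp: code_prod_def)

lemma computable_snd [computable_intros]:
  "computable f \<Longrightarrow> computable (\<lambda>x. snd (f x))"
  by (rule computable_compose[of snd, OF computableI[OF recursive_function_snd]])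
    (auto simp: code_prod_def)

lemma computable_prod_encode [computable_intros]:
  assumes "computable f" shows "computable (\<lambda>x. prod_encode (f x))"
proof -
  have "prod_encode p = code p" for p :: "nat \<times> nat" by (simp add: code_prod_def)
  with computable_code[OF assms] show ?thesis by simp
qed

lemma computable_prod_decode [computable_intros]:
  assumes "computable f" shows "computable (\<lambda>x. prod_decode (f x))"
proof -
  have "prod_decode n = decode n" for n by (simp add: decode_pair)
  moreover have "computable (\<lambda>x. decode (f x) :: nat \<times> nat)"
    by (rule computable_decode[OF assms])
  ultimately show ?thesis by simp
qed

lemma computable_Suc [computable_intros]: "computable f \<Longrightarrow> computable (\<lambda>x. Suc (f x))"
  by (rule computable_compose[of Suc]) (simp add: computable_nat_iff recursive_function_Suc)

text \<open>The recursion is carried out on codes: \<open>?g\<close> decodes counter, previous value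
  and parameter, applies the step and codes the result.\<close>

lemma computable_rec_nat [computable_intros]:
  fixes a :: "'a::coded \<Rightarrow> 'b::coded"
  assumes a: "computable a" and g: "computable (\<lambda>p. g (fst p) (fst (snd p)) (snd (snd p)))"
    and c: "computable c"
  shows "computable (\<lambda>x. rec_nat (a x) (\<lambda>n r. g x n r) (c x))"
proof -
  let ?G = "\<lambda>p::'a \<times> nat \<times> 'b. g (fst p) (fst (snd p)) (snd (snd p))"
  let ?g = "\<lambda>z. code (?G (decode (snd (snd (decode z :: nat \<times> nat \<times> nat))),
      fst (decode z :: nat \<times> nat \<times> nat),
      decode (fst (snd (decode z :: nat \<times> nat \<times> nat)))))"
  have "computable ?g"
    by (rule computable_code, rule computable_compose[OF g]) (intro computable_intros)
  then have 1: "recursive_function ?g" by (simp add: computable_nat_iff)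
  have 2: "code (rec_nat (a x) (\<lambda>n r. g x n r) m) = rec_nat (code (a x))
      (\<lambda>n r. ?g (prod_encode (n, prod_encode (r, code x)))) m" for x m
  proof (induction m)
    case (Suc m)
    show ?case by (simp add: decode_pair Suc[simplified decode_pair, simplified, symmetric])
  qed simp
  have "recursive_function (\<lambda>x. rec_nat (code (a (decode x)))
      (\<lambda>n r. ?g (prod_encode (n, prod_encode (r, x)))) (c (decode x)))"
    using a c unfolding computable_def by (intro recursive_function_rec 1) simp_all
  then show ?thesis
    by (rule computableI) (simp only: 2 decode_code)
qed

lemma computable_plus [computable_intros]:
  fixes a b :: "'a::coded \<Rightarrow> nat"
  assumes "computable a" "computable b" shows "computable (\<lambda>x. a x + b x)"
proof -
  have "rec_nat x (\<lambda>n r. Suc r) y = x + y" for x y by (induction y) auto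
  moreover have "computable (\<lambda>x. rec_nat (a x) (\<lambda>n r. Suc r) (b x))"
    by (intro computable_intros assms)
  ultimately show ?thesis by simp
qed

lemma computable_diff [computable_intros]:
  fixes a b :: "'a::coded \<Rightarrow> nat"
  assumes "computable a" "computable b" shows "computable (\<lambda>x. a x - b x)"
proof -
  have "rec_nat 0 (\<lambda>n r. n) x = x - 1" for x by (cases x) auto
  then have "rec_nat x (\<lambda>n r. rec_nat 0 (\<lambda>n r. n) r) y = x - y" for x y
    by (induction y) auto
  moreover have "computable (\<lambda>x. rec_nat (a x) (\<lambda>n r. rec_nat 0 (\<lambda>n r. n) r) (b x))"
    by (intro computable_intros assms)
  ultimately show ?thesis by simp
qed

lemma computable_case_nat [computable_intros]:
  assumes "computable a" "computable c" "computable (\<lambda>p. g (fst p) (snd p))"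
  shows "computable (\<lambda>x. case c x of 0 \<Rightarrow> a x | Suc n \<Rightarrow> g x n)"
proof -
  have "rec_nat (a x) (\<lambda>n r. g x n) m = (case m of 0 \<Rightarrow> a x | Suc n \<Rightarrow> g x n)" for x m
    by (cases m) auto
  moreover have "computable (\<lambda>x. rec_nat (a x) (\<lambda>n r. g x n) (c x))"
    by (intro computable_rec_nat assms computable_compose[OF assms(3),
          where g="\<lambda>p. (fst p, fst (snd p))", simplified] computable_intros)
  ultimately show ?thesis by simp
qed

lemma computable_Cons [computable_intros]:
  assumes "computable f" "computable g" shows "computable (\<lambda>x. f x # g x)"
  using computable_Suc[OF computable_code[OF computable_Pair[OF assms]]]
  unfolding computable_def code_Cons code_nat_def .

text \<open>The code of \<open>[]\<close> is 0 and that of a nonempty list is the successor of the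
  code of head and tail, so this is a case distinction on the code.\<close>

lemma computable_case_list [computable_intros]:
  fixes l :: "'a::coded \<Rightarrow> 'b::coded list"
  assumes "computable a" "computable l"
    and g: "computable (\<lambda>p. g (fst p) (fst (snd p)) (snd (snd p)))"
  shows "computable (\<lambda>x. case l x of [] \<Rightarrow> a x | y # ys \<Rightarrow> g x y ys)"
proof -
  let ?d = "\<lambda>n. decode n :: 'b \<times> 'b list"
  have "(case m of 0 \<Rightarrow> a x | Suc n \<Rightarrow> g x (fst (?d n)) (snd (?d n))) =
      (case xs of [] \<Rightarrow> a x | y # ys \<Rightarrow> g x y ys)" if "m = code xs" for x xs m
    unfolding that by (cases xs) (auto simp: code_Nil code_Cons simp del: code_pair)
  moreover have "computable (\<lambda>x. case code (l x) of 0 \<Rightarrow> a x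
      | Suc n \<Rightarrow> g x (fst (?d n)) (snd (?d n)))"
    by (intro assms computable_compose[OF g, where g="\<lambda>p. (fst p, ?d (snd p))", simplified]
        computable_intros)
  ultimately show ?thesis by simp
qed

lemma computable_drop [computable_intros]:
  fixes l :: "'a::coded \<Rightarrow> 'b::coded list"
  assumes "computable k" "computable l" shows "computable (\<lambda>x. drop (k x) (l x))"
proof -
  have "rec_nat l (\<lambda>n r. case r of [] \<Rightarrow> [] | y # ys \<Rightarrow> ys) k = drop k l" for k and l :: "'b list"
    by (induction k) (simp_all add: drop_Suc tl_drop tl_def[symmetric] flip: drop_tl)
  moreover have "computable (\<lambda>x. rec_nat (l x) (\<lambda>n r. case r of [] \<Rightarrow> [] | y # ys \<Rightarrow> ys) (k x))"
    by (intro assms computable_intros)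
  ultimately show ?thesis by simp
qed

text \<open>The recursion carries the unread rest of the list along with the accumulator. It runs
  \<open>code (l x)\<close> times, at least as often as there are elements, and is idle once the
  list is exhausted.\<close>

lemma computable_fold [computable_intros]:
  fixes l :: "'a::coded \<Rightarrow> 'b::coded list" and a :: "'a \<Rightarrow> 'c::coded"
  assumes "computable l" "computable a"
    and g: "computable (\<lambda>p. g (fst p) (fst (snd p)) (snd (snd p)))"
  shows "computable (\<lambda>x. fold (g x) (l x) (a x))"
proof -
  let ?step = "\<lambda>x r. case fst r of [] \<Rightarrow> r | y # ys \<Rightarrow> (ys, g x y (snd r))"
  have *: "rec_nat (xs, a) (\<lambda>n r. ?step x r) m = (drop m xs, fold (g x) (take m xs) a)"
    for x m xs a
  proof (induction m)
    case (Suc m)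
    show ?case
    proof (cases "m < length xs")
      case True
      then have "drop m xs = xs ! m # drop (Suc m) xs" by (simp add: Cons_nth_drop_Suc)
      with Suc True show ?thesis by (simp add: take_Suc_conv_app_nth)
    next
      case False
      with Suc show ?thesis by simp
    qed
  qed simp
  have "computable (\<lambda>x. snd (rec_nat (l x, a x) (\<lambda>n r. ?step x r) (code (l x))))"
    by (intro assms computable_compose[OF g,
          where g="\<lambda>p. (fst (fst p), fst (snd p), snd (snd (snd (fst p))))", simplified]
        computable_intros)
  then show ?thesis unfolding * by (simp add: length_le_code)
qed

lemma computable_length [computable_intros]:
  fixes l :: "'a::coded \<Rightarrow> 'b::coded list"
  assumes "computable l" shows "computable (\<lambda>x. length (l x))"
proof -
  have "fold (\<lambda>y n. Suc n) xs m = length xs + m"  for xs :: "'b list" and m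
    by (induction xs arbitrary: m) auto
  moreover have "computable (\<lambda>x. fold (\<lambda>y n. Suc n) (l x) 0)"
    by (intro assms computable_intros)
  ultimately show ?thesis by simp
qed

lemma computable_map_upt [computable_intros]:
  fixes n :: "'a::coded \<Rightarrow> nat"
  assumes n: "computable n" and h: "computable (\<lambda>p. h (fst p) (snd p))"
  shows "computable (\<lambda>x. map (h x) [0..<n x])"
proof -
  \<comment> \<open>Prepending is the available operation, so the list is built from its last entry
    backwards; after \<open>m\<close> steps it covers the last \<open>m\<close> indices.\<close>
  have *: "m \<le> N \<Longrightarrow> rec_nat [] (\<lambda>m r. h x (N - Suc m) # r) m = map (h x) [N - m..<N]" for x m N
  proof (induction m)
    case (Suc m)
    then have "[N - Suc m..<N] = (N - Suc m) # [N - m..<N]"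
      using upt_rec[of "N - Suc m" N] by (simp add: Suc_diff_Suc)
    with Suc show ?case by simp
  qed simp
  have "computable (\<lambda>x. rec_nat [] (\<lambda>m r. h x (n x - Suc m) # r) (n x))"
    by (intro computable_intros n computable_compose[OF n]
        computable_compose[OF h, where g="\<lambda>p. (fst p, n (fst p) - Suc (fst (snd p)))", simplified])
  then show ?thesis by (simp add: *)
qed

section \<open>Decidable predicates\<close>

definition decidable :: "('a::coded \<Rightarrow> bool) \<Rightarrow> bool" where
  "decidable P \<longleftrightarrow> computable (\<lambda>x. if P x then 1 else 0 :: nat)"

lemma computable_if [computable_intros]:
  assumes "decidable P" "computable a" "computable b"
  shows "computable (\<lambda>x. if P x then a x else b x)"
proof -
  have "computable (\<lambda>x. case (if P x then 1 else 0 :: nat) of 0 \<Rightarrow> b x | Suc n \<Rightarrow> a x)"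
    by (intro computable_intros assms assms(1)[unfolded decidable_def]
        computable_compose[OF assms(2)])
  moreover have "(case (if P x then 1 else 0 :: nat) of 0 \<Rightarrow> b x | Suc n \<Rightarrow> a x) =
      (if P x then a x else b x)" for x by simp
  ultimately show ?thesis by simp
qed

lemma decidable_compose:
  "decidable P \<Longrightarrow> computable f \<Longrightarrow> decidable (\<lambda>x. P (f x))"
  unfolding decidable_def by (rule computable_compose)

lemma decidable_const [computable_intros]: "decidable (\<lambda>x. b)"
  unfolding decidable_def by (rule computable_const)

lemma decidable_not [computable_intros]:
  assumes "decidable P" shows "decidable (\<lambda>x. \<not> P x)"
proof -
  have "computable (\<lambda>x. if P x then 0 else 1 :: nat)" by (intro computable_intros assms)
  moreover have "(if P x then 0 else 1) = (if \<not> P x then 1 else 0 :: nat)" for x by simp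
  ultimately show ?thesis by (simp add: decidable_def)
qed

lemma decidable_conj [computable_intros]:
  assumes "decidable P" "decidable Q" shows "decidable (\<lambda>x. P x \<and> Q x)"
proof -
  have "computable (\<lambda>x. if P x then if Q x then 1 else 0 else 0 :: nat)"
    by (intro computable_intros assms)
  moreover have "(if P x then if Q x then 1 else 0 else 0) = (if P x \<and> Q x then 1 else 0 :: nat)" for x
    by simp
  ultimately show ?thesis by (simp add: decidable_def)
qed

lemma decidable_disj [computable_intros]:
  assumes "decidable P" "decidable Q" shows "decidable (\<lambda>x. P x \<or> Q x)"
  using decidable_not[OF decidable_conj[OF decidable_not decidable_not, OF assms]] by simp

lemma decidable_imp [computable_intros]:
  assumes "decidable P" "decidable Q" shows "decidable (\<lambda>x. P x \<longrightarrow> Q x)"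
  using decidable_disj[OF decidable_not, OF assms] by (simp only: imp_conv_disj)

lemma decidable_if [computable_intros]:
  assumes "decidable P" "decidable Q" "decidable R"
  shows "decidable (\<lambda>x. if P x then Q x else R x)"
  unfolding if_bool_eq_conj by (intro computable_intros assms)

lemma decidable_less [computable_intros]:
  fixes a b :: "'a::coded \<Rightarrow> nat"
  assumes "computable a" "computable b" shows "decidable (\<lambda>x. a x < b x)"
proof -
  have "computable (\<lambda>x. case b x - a x of 0 \<Rightarrow> (0::nat) | Suc n \<Rightarrow> 1)"
    by (intro computable_intros assms)
  moreover have "(case b x - a x of 0 \<Rightarrow> 0 | Suc n \<Rightarrow> 1) = (if a x < b x then 1 else 0 :: nat)" for x
    by (auto split: nat.splits)
  ultimately show ?thesis by (simp add: decidable_def)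
qed

lemma decidable_le [computable_intros]:
  fixes a b :: "'a::coded \<Rightarrow> nat"
  assumes "computable a" "computable b" shows "decidable (\<lambda>x. a x \<le> b x)"
  using decidable_not[OF decidable_less[OF assms(2,1)]] by (simp add: not_less)

lemma decidable_eq [computable_intros]:
  assumes "computable a" "computable b" shows "decidable (\<lambda>x. a x = b x)"
proof -
  have "decidable (\<lambda>x. code (a x) \<le> code (b x) \<and> code (b x) \<le> code (a x))"
    by (intro computable_intros assms)
  then show ?thesis by (simp add: order_eq_iff[symmetric])
qed

lemma decidable_case_list [computable_intros]:
  assumes "decidable a" "computable l" "decidable (\<lambda>p. g (fst p) (fst (snd p)) (snd (snd p)))"
  shows "decidable (\<lambda>x. case l x of [] \<Rightarrow> a x | y # ys \<Rightarrow> g x y ys)"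
proof -
  have "computable (\<lambda>x. case l x of [] \<Rightarrow> (if a x then 1 else 0 :: nat)
      | y # ys \<Rightarrow> if g x y ys then 1 else 0)"
    using assms unfolding decidable_def by (rule computable_case_list)
  moreover have "(case l x of [] \<Rightarrow> if a x then 1 else 0 | y # ys \<Rightarrow> if g x y ys then 1 else 0) =
      (if case l x of [] \<Rightarrow> a x | y # ys \<Rightarrow> g x y ys then 1 else 0 :: nat)" for x
    by (simp split: list.splits)
  ultimately show ?thesis by (simp add: decidable_def)
qed

lemma decidable_case_nat [computable_intros]:
  assumes "decidable a" "computable c" "decidable (\<lambda>p. g (fst p) (snd p))"
  shows "decidable (\<lambda>x. case c x of 0 \<Rightarrow> a x | Suc n \<Rightarrow> g x n)"
proof -
  have "computable (\<lambda>x. case c x of 0 \<Rightarrow> (if a x then 1 else 0 :: nat)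
      | Suc n \<Rightarrow> if g x n then 1 else 0)"
    using assms unfolding decidable_def by (rule computable_case_nat)
  moreover have "(case c x of 0 \<Rightarrow> if a x then 1 else 0 | Suc n \<Rightarrow> if g x n then 1 else 0) =
      (if case c x of 0 \<Rightarrow> a x | Suc n \<Rightarrow> g x n then 1 else 0 :: nat)" for x
    by (simp split: nat.splits)
  ultimately show ?thesis by (simp add: decidable_def)
qed

lemma decidable_ball_set [computable_intros]:
  fixes l :: "'a::coded \<Rightarrow> 'b::coded list"
  assumes "computable l" and P: "decidable (\<lambda>p. P (fst p) (snd p))"
  shows "decidable (\<lambda>x. \<forall>y\<in>set (l x). P x y)"
proof -
  have *: "fold (\<lambda>y r. if P x y then r else 0) xs r = (if \<forall>y\<in>set xs. P x y then r else 0 :: nat)"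
    for x xs r by (induction xs arbitrary: r) auto
  have "computable (\<lambda>x. fold (\<lambda>y r. if P x y then r else 0) (l x) (1 :: nat))"
    by (intro computable_intros assms
        decidable_compose[OF P, where f="\<lambda>p. (fst p, fst (snd p))", simplified])
  then show ?thesis by (simp only: decidable_def *)
qed

lemma decidable_bex_set [computable_intros]:
  fixes l :: "'a::coded \<Rightarrow> 'b::coded list"
  assumes "computable l" "decidable (\<lambda>p. P (fst p) (snd p))"
  shows "decidable (\<lambda>x. \<exists>y\<in>set (l x). P x y)"
  using decidable_not[OF decidable_ball_set[OF assms(1) decidable_not[OF assms(2)]]] by simp

lemma decidable_in_set [computable_intros]:
  fixes l :: "'a::coded \<Rightarrow> 'b::coded list"
  assumes "computable a" "computable l" shows "decidable (\<lambda>x. a x \<in> set (l x))"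
proof -
  have "decidable (\<lambda>x. \<exists>y\<in>set (l x). y = a x)"
    by (intro computable_intros assms computable_compose[OF assms(1)])
  then show ?thesis by simp
qed

lemma decidable_all_less [computable_intros]:
  fixes n :: "'a::coded \<Rightarrow> nat"
  assumes "computable n" "decidable (\<lambda>p. P (fst p) (snd p))"
  shows "decidable (\<lambda>x. \<forall>i<n x. P x i)"
proof -
  have "decidable (\<lambda>x. \<forall>i\<in>set (map (\<lambda>i. i) [0..<n x]). P x i)"
    by (intro computable_intros assms)
  then show ?thesis by (simp add: Ball_def)
qed

section \<open>Recursively enumerable sets and a universal predicate\<close>

text \<open>The first component marks the constructor and the second codes the rest, so that
  \<open>justified\<close> can take a scheme apart arithmetically. Numbers that code no scheme may
  occur in entries; \<open>valid_sound\<close> speaks only of the others.\<close>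

primrec scheme_code :: "scheme \<Rightarrow> nat" where
  "scheme_code Zero = prod_encode (0, 0)"
| "scheme_code Succ = prod_encode (1, 0)"
| "scheme_code (Proj i) = prod_encode (2, i)"
| "scheme_code (Compose f gs) = prod_encode (3, code (scheme_code f, map scheme_code gs))"
| "scheme_code (Prec f g) = prod_encode (4, code (scheme_code f, scheme_code g))"
| "scheme_code (Mu f) = prod_encode (5, scheme_code f)"

text \<open>A total variant of \<open>!\<close>, whose value outside the list is unspecified; the
  default 0 makes it computable.\<close>

definition nth0 :: "nat list \<Rightarrow> nat \<Rightarrow> nat" where
  "nth0 xs k = (case drop k xs of [] \<Rightarrow> 0 | y # ys \<Rightarrow> y)"

lemma nth0_eq: "nth0 xs k = (if k < length xs then xs ! k else 0)"
  by (auto simp: nth0_def Cons_nth_drop_Suc[symmetric])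

lemma computable_nth0 [computable_intros]:
  "computable l \<Longrightarrow> computable k \<Longrightarrow> computable (\<lambda>x. nth0 (l x) (k x))"
  unfolding nth0_def by (intro computable_intros)

type_synonym entry = "nat \<times> nat list \<times> nat"

text \<open>An entry \<open>(c, xs, y)\<close> asserts that the scheme with code \<open>c\<close> maps \<open>xs\<close> to \<open>y\<close>.
  It is justified by \<open>L\<close> if it follows from entries of \<open>L\<close> by one rule for
  \<^const>\<open>computes\<close>.\<close>

definition justified :: "entry list \<Rightarrow> nat \<Rightarrow> nat list \<Rightarrow> nat \<Rightarrow> bool" where
  "justified L c xs y \<longleftrightarrow>
    (if fst (prod_decode c) = 0 then y = 0
     else if fst (prod_decode c) = 1 then (case xs of [] \<Rightarrow> False | x # us \<Rightarrow> us = [] \<and> y = Suc x)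
     else if fst (prod_decode c) = 2 then
       (case drop (snd (prod_decode c)) xs of [] \<Rightarrow> False | x # us \<Rightarrow> y = x)
     else if fst (prod_decode c) = 3 then
       (\<exists>e\<in>set L. fst e = fst (decode (snd (prod_decode c)) :: nat \<times> nat list) \<and> snd (snd e) = y \<and>
         length (fst (snd e)) = length (snd (decode (snd (prod_decode c)) :: nat \<times> nat list)) \<and>
         (\<forall>k<length (fst (snd e)).
           (nth0 (snd (decode (snd (prod_decode c)) :: nat \<times> nat list)) k, xs, nth0 (fst (snd e)) k)
             \<in> set L))
     else if fst (prod_decode c) = 4 then
       (case xs of [] \<Rightarrow> False
        | n # us \<Rightarrow> (case n of
            0 \<Rightarrow> (fst (decode (snd (prod_decode c)) :: nat \<times> nat), us, y) \<in> set L
          | Suc m \<Rightarrow> (\<exists>e\<in>set L. fst e = c \<and> fst (snd e) = m # us \<and>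
              (snd (decode (snd (prod_decode c)) :: nat \<times> nat), m # snd (snd e) # us, y) \<in> set L)))
     else if fst (prod_decode c) = 5 then
       (snd (prod_decode c), y # xs, 0) \<in> set L \<and>
       (\<forall>i<y. \<exists>e\<in>set L. fst e = snd (prod_decode c) \<and> fst (snd e) = i # xs \<and> snd (snd e) \<noteq> 0)
     else False)"

lemma bex_triple: "(\<exists>e\<in>A. P e) \<longleftrightarrow> (\<exists>a b c. (a, b, c) \<in> A \<and> P (a, b, c))"
  by auto

text \<open>Each clause recovers the premises of a rule of \<open>computes\<close>, with membership
  in \<open>L\<close> in place of \<open>computes\<close>.\<close>

lemma justified_Zero: "justified L (scheme_code Zero) xs y \<longleftrightarrow> y = 0"
  and justified_Succ: "justified L (scheme_code Succ) xs y \<longleftrightarrow> (\<exists>x. xs = [x] \<and> y = Suc x)"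
  and justified_Proj:
    "justified L (scheme_code (Proj i)) xs y \<longleftrightarrow> i < length xs \<and> y = xs ! i"
  and justified_Compose: "justified L (scheme_code (Compose f gs)) xs y \<longleftrightarrow>
    (\<exists>ys. (scheme_code f, ys, y) \<in> set L \<and>
      list_all2 (\<lambda>g y. (scheme_code g, xs, y) \<in> set L) gs ys)"
  and justified_Prec_0:
    "justified L (scheme_code (Prec f g)) (0 # us) y \<longleftrightarrow> (scheme_code f, us, y) \<in> set L"
  and justified_Prec_Suc:
    "justified L (scheme_code (Prec f g)) (Suc m # us) y \<longleftrightarrow>
      (\<exists>r. (scheme_code (Prec f g), m # us, r) \<in> set L \<and> (scheme_code g, m # r # us, y) \<in> set L)"
  and justified_Prec_Nil: "\<not> justified L (scheme_code (Prec f g)) [] y"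
  and justified_Mu: "justified L (scheme_code (Mu f)) xs y \<longleftrightarrow>
    (scheme_code f, y # xs, 0) \<in> set L \<and> (\<forall>i<y. \<exists>z. (scheme_code f, i # xs, Suc z) \<in> set L)"
proof -
  have nth0_map: "nth0 (map scheme_code gs) k = scheme_code (gs ! k)" if "k < length gs" for k
    using that by (simp add: nth0_eq)
  have "justified L (scheme_code (Compose f gs)) xs y \<longleftrightarrow>
    (\<exists>ys. (scheme_code f, ys, y) \<in> set L \<and> length ys = length gs \<and>
      (\<forall>k<length ys. (nth0 (map scheme_code gs) k, xs, nth0 ys k) \<in> set L))"
    by (simp add: justified_def bex_triple del: code_pair)
  also have "\<dots> \<longleftrightarrow> (\<exists>ys. (scheme_code f, ys, y) \<in> set L \<and>
      list_all2 (\<lambda>g y. (scheme_code g, xs, y) \<in> set L) gs ys)"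
    by (intro ex_cong1 conj_cong refl) (auto simp: list_all2_conv_all_nth nth0_eq nth0_map)
  finally show "justified L (scheme_code (Compose f gs)) xs y \<longleftrightarrow>
    (\<exists>ys. (scheme_code f, ys, y) \<in> set L \<and>
      list_all2 (\<lambda>g y. (scheme_code g, xs, y) \<in> set L) gs ys)" .
  have "(\<exists>z. (a, b, z) \<in> A \<and> 0 < z) \<longleftrightarrow> (\<exists>z. (a, b, Suc z) \<in> A)"
    for a b and A :: "entry set" by (metis gr0_implies_Suc zero_less_Suc)
  then show "justified L (scheme_code (Mu f)) xs y \<longleftrightarrow>
    (scheme_code f, y # xs, 0) \<in> set L \<and> (\<forall>i<y. \<exists>z. (scheme_code f, i # xs, Suc z) \<in> set L)"
    by (simp add: justified_def bex_triple)
  have "i < length xs \<Longrightarrow> drop i xs = xs ! i # drop (Suc i) xs" by (rule Cons_nth_drop_Suc[symmetric])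
  then show "justified L (scheme_code (Proj i)) xs y \<longleftrightarrow> i < length xs \<and> y = xs ! i"
    by (cases "i < length xs") (simp_all add: justified_def)
qed (auto simp: justified_def bex_triple simp del: code_pair split: list.splits)

text \<open>\<open>L\<close> occurs only positively in \<open>justified\<close>.\<close>

lemma justified_mono: "set L \<subseteq> set M \<Longrightarrow> justified L c xs y \<Longrightarrow> justified M c xs y"
  unfolding justified_def by (simp split: if_splits list.splits nat.splits) blast+

lemma decidable_justified [computable_intros]:
  assumes "computable l" "computable c" "computable xs" "computable y"
  shows "decidable (\<lambda>p. justified (l p) (c p) (xs p) (y p))"
proof -
  have "decidable (\<lambda>p. justified (fst p) (fst (snd p)) (fst (snd (snd p))) (snd (snd (snd p))))"
    unfolding justified_def by (intro computable_intros)
  from decidable_compose[OF this, of "\<lambda>p. (l p, c p, xs p, y p)"] assms show ?thesis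
    by (simp add: computable_Pair)
qed

text \<open>A derivation with its conclusion first. The form with \<open>drop\<close> and a bounded
  quantifier falls under the closure rules for \<open>decidable\<close>; inductions use
  \<open>valid_Cons\<close>.\<close>

definition valid :: "entry list \<Rightarrow> bool" where
  "valid L \<longleftrightarrow> (\<forall>k<length L. case drop k L of [] \<Rightarrow> True
    | e # M \<Rightarrow> justified M (fst e) (fst (snd e)) (snd (snd e)))"

lemma valid_Nil: "valid []"
  and valid_Cons: "valid (e # L) \<longleftrightarrow> justified L (fst e) (fst (snd e)) (snd (snd e)) \<and> valid L"
  by (simp_all add: valid_def All_less_Suc2)

lemma valid_append: "valid L \<Longrightarrow> valid M \<Longrightarrow> valid (L @ M)"
  by (induction L) (auto simp: valid_Cons intro: justified_mono[rotated])

lemma valid_sound: "valid L \<Longrightarrow> (scheme_code p, xs, y) \<in> set L \<Longrightarrow> computes p xs y"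
proof (induction L arbitrary: p xs y)
  case (Cons e L)
  then have IH: "\<And>p xs y. (scheme_code p, xs, y) \<in> set L \<Longrightarrow> computes p xs y"
    by (simp add: valid_Cons)
  show ?case
  proof (cases "(scheme_code p, xs, y) \<in> set L")
    case False
    with Cons.prems have j: "justified L (scheme_code p) xs y" by (auto simp: valid_Cons)
    show ?thesis
    proof (cases p)
      case (Compose f gs)
      with j obtain ys where "computes f ys y" "list_all2 (\<lambda>g y. computes g xs y) gs ys"
        unfolding Compose justified_Compose by (blast intro: IH list_all2_mono)
      with Compose show ?thesis by (auto intro: computes.Compose)
    next
      case (Prec f g)
      show ?thesis
      proof (cases xs)
        case Nil
        with j Prec show ?thesis by (simp only: justified_Prec_Nil)
      next
        case (Cons n us)
        with j Prec show ?thesis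
          by (cases n) (auto simp only: justified_Prec_0 justified_Prec_Suc
              intro: computes.Prec_0 computes.Prec_Suc IH)
      qed
    next
      case (Mu f)
      with j show ?thesis
        unfolding Mu justified_Mu by (blast intro: computes.Mu IH)
    qed (use j in \<open>auto simp only: justified_Zero justified_Succ justified_Proj
        intro: computes.intros\<close>)
  qed (rule IH)
qed simp

section \<open>Completeness of derivations\<close>

definition derivable :: "entry \<Rightarrow> bool" where
  "derivable e \<longleftrightarrow> (\<exists>L. valid L \<and> e \<in> set L)"

text \<open>Derivations of the finitely many premises in \<open>S\<close> are concatenated, and the
  conclusion is put in front.\<close>

lemma derivableI:
  assumes "finite S" "\<And>e. e \<in> S \<Longrightarrow> derivable e"
    and "\<And>L. S \<subseteq> set L \<Longrightarrow> justified L c xs y"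
  shows "derivable (c, xs, y)"
proof -
  from assms(1,2) have "\<exists>L. valid L \<and> S \<subseteq> set L"
  proof (induction S rule: finite_induct)
    case (insert e S)
    then obtain L M where "valid L" "S \<subseteq> set L" "valid M" "e \<in> set M"
      unfolding derivable_def by blast
    then show ?case by (intro exI[of _ "L @ M"]) (auto simp: valid_append)
  qed (auto intro: exI[of _ "[]"] simp: valid_Nil)
  then obtain L where "valid L" "S \<subseteq> set L" by blast
  then show ?thesis
    unfolding derivable_def by (intro exI[of _ "(c, xs, y) # L"]) (simp add: valid_Cons assms(3))
qed

lemma computes_derivable: "computes p xs y \<Longrightarrow> derivable (scheme_code p, xs, y)"
proof (induction rule: computes.induct)
  case (Zero xs)
  show ?case by (rule derivableI[of "{}"]) (simp_all only: justified_Zero, auto)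
next
  case (Succ x)
  show ?case by (rule derivableI[of "{}"]) (simp_all only: justified_Succ, auto)
next
  case (Proj i xs)
  then show ?case by (intro derivableI[of "{}"]) (simp_all only: justified_Proj, auto)
next
  case (Compose xs gs ys f z)
  let ?S = "insert (scheme_code f, ys, z) ((\<lambda>i. (scheme_code (gs ! i), xs, ys ! i)) ` {..<length gs})"
  show ?case
  proof (rule derivableI[of ?S])
    show "derivable e" if "e \<in> ?S" for e
      using that Compose.IH by (auto simp: list_all2_conv_all_nth)
    show "justified L (scheme_code (Compose f gs)) xs z" if "?S \<subseteq> set L" for L
      unfolding justified_Compose
      using that Compose.IH by (intro exI[of _ ys]) (auto simp: list_all2_conv_all_nth)
  qed simp
next
  case (Prec_0 f xs y g)
  then show ?case
    by (intro derivableI[of "{(scheme_code f, xs, y)}"]) (simp_all only: justified_Prec_0, auto)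
next
  case (Prec_Suc f g n xs r y)
  then show ?case
    by (intro derivableI[of "{(scheme_code (Prec f g), n # xs, r), (scheme_code g, n # r # xs, y)}"])
      (simp_all only: justified_Prec_Suc, auto)
next
  case (Mu f n xs)
  from Mu.IH(2) obtain h where h: "\<And>i. i < n \<Longrightarrow> derivable (scheme_code f, i # xs, Suc (h i))"
    by metis
  let ?S = "insert (scheme_code f, n # xs, 0) ((\<lambda>i. (scheme_code f, i # xs, Suc (h i))) ` {..<n})"
  show ?case
  proof (rule derivableI[of ?S])
    show "derivable e" if "e \<in> ?S" for e using that Mu.IH(1) h by auto
    show "justified L (scheme_code (Mu f)) xs n" if "?S \<subseteq> set L" for L
      using that unfolding justified_Mu by auto
  qed simp
qed

section \<open>Normal form of recursively enumerable sets\<close>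

definition halts :: "nat \<Rightarrow> nat \<Rightarrow> entry list \<Rightarrow> bool" where
  "halts c z L \<longleftrightarrow> valid L \<and> (\<exists>e\<in>set L. fst e = c \<and> fst (snd e) = [z])"

lemma decidable_halts [computable_intros]:
  assumes "computable c" "computable z" "computable l"
  shows "decidable (\<lambda>p. halts (c p) (z p) (l p))"
proof -
  have "decidable (\<lambda>p. halts (fst p) (fst (snd p)) (snd (snd p)))"
    unfolding halts_def valid_def by (intro computable_intros)
  from decidable_compose[OF this, of "\<lambda>p. (c p, z p, l p)"] assms show ?thesis
    by (simp add: computable_Pair)
qed

text \<open>Kleene's normal form: \<open>c\<close> is the code of a scheme for \<open>X\<close>, and
  a valid list takes the part of the computation in Kleene's T predicate.\<close>

lemma re_sets_halts:
  assumes "X \<in> re_sets" obtains c where "X = {z. \<exists>L. halts c z L}"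
proof -
  from assms obtain p where X: "X = {z. \<exists>y. computes p [z] y}" unfolding re_sets_def by auto
  have "(\<exists>y. computes p [z] y) \<longleftrightarrow> (\<exists>L. halts (scheme_code p) z L)" for z
  proof
    assume "\<exists>y. computes p [z] y"
    then obtain y L where "valid L" "(scheme_code p, [z], y) \<in> set L"
      using computes_derivable unfolding derivable_def by blast
    then show "\<exists>L. halts (scheme_code p) z L"
      unfolding halts_def by (intro exI[of _ L] conjI bexI[of _ "(scheme_code p, [z], y)"]) auto
  next
    assume "\<exists>L. halts (scheme_code p) z L"
    then obtain L y where "valid L" "(scheme_code p, [z], y) \<in> set L"
      by (auto simp: halts_def)
    then show "\<exists>y. computes p [z] y" using valid_sound by blast
  qed
  with X show ?thesis by (intro that[of "scheme_code p"]) simp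
qed

lemma re_sets_decidable:
  assumes "X \<in> re_sets"
  obtains R :: "nat \<Rightarrow> entry list \<Rightarrow> bool"
  where "decidable (\<lambda>p. R (fst p) (snd p))" "X = {z. \<exists>t. R z t}"
proof -
  from assms obtain c where "X = {z. \<exists>L. halts c z L}" by (rule re_sets_halts)
  moreover have "decidable (\<lambda>p. halts c (fst p) (snd p))" by (intro computable_intros)
  ultimately show ?thesis using that by blast
qed

text \<open>The converse of \<open>re_sets_decidable\<close>, by an unbounded search through the
  codes of \<open>t\<close>.\<close>

lemma re_setsI:
  fixes R :: "nat \<Rightarrow> 'a::coded \<Rightarrow> bool"
  assumes "decidable (\<lambda>p. R (fst p) (snd p))"
  shows "{z. \<exists>t. R z t} \<in> re_sets"
proof -
  \<comment> \<open>Truth is represented by 0, the value that \<open>Mu\<close> searches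
    for.\<close>
  let ?h = "\<lambda>n. if R (fst (prod_decode n)) (decode (snd (prod_decode n))) then 0 else 1 :: nat"
  have "computable ?h"
    by (intro computable_intros
        decidable_compose[OF assms, where f="\<lambda>n. (fst (prod_decode n), decode (snd (prod_decode n)))",
          simplified])
  then have "recursive_function ?h" by (simp only: computable_nat_iff)
  \<comment> \<open>\<open>Mu\<close> places the search variable in front, so \<open>xs ! 0\<close>
    is the code tried and \<open>xs ! 1\<close> the input.\<close>
  then have "nary 2 (\<lambda>xs. ?h (prod_encode (xs ! 1, xs ! 0)))"
    by (rule nary_recursive_function) (intro nary_prod_encode nary_proj; simp)
  then obtain p where p: "\<And>xs. length xs = 2 \<Longrightarrow> computes p xs (?h (prod_encode (xs ! 1, xs ! 0)))"
    unfolding nary_def by auto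
  have p': "computes p [n, z] (if R z (decode n) then 0 else 1)" for n z
    using p[of "[n, z]"] by simp
  have "(\<exists>y. computes (Mu p) [z] y) \<longleftrightarrow> (\<exists>t. R z t)" for z
  proof
    assume "\<exists>y. computes (Mu p) [z] y"
    then obtain n where "computes p [n, z] 0" by (auto elim: computes_MuE)
    from computes_deterministic[OF this p'[of n z]] have "R z (decode n)"
      by (simp split: if_splits)
    then show "\<exists>t. R z t" by blast
  next
    assume "\<exists>t. R z t"
    then obtain t where "R z t" by blast
    then have ex: "\<exists>n. R z (decode n)" by (intro exI[of _ "code t"]) simp
    define n where "n = (LEAST n. R z (decode n))"
    have "computes p [n, z] 0" using p'[of n z] LeastI_ex[OF ex] by (simp add: n_def)
    moreover have "\<exists>y. computes p [i, z] (Suc y)" if "i < n" for i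
      using p'[of i z] not_less_Least[OF that[unfolded n_def]] by auto
    ultimately show "\<exists>y. computes (Mu p) [z] y" by (blast intro: computes.Mu)
  qed
  then show ?thesis unfolding re_sets_def by blast
qed

section \<open>The diagonal set\<close>

text \<open>A witness has the form ((n, e), k): its requirement (n, e) pairs a column
  \<open>n\<close> with an index \<open>e\<close> of an r.e. relation.\<close>

definition column :: "nat \<Rightarrow> nat" where
  "column w = fst (prod_decode (fst (prod_decode w)))"

text \<open>The proposal \<open>(i, k, l, v, L, M)\<close> asks that requirement \<open>i\<close> enumerate its \<open>k\<close>-th witness
  \<open>w\<close>, on the ground that \<open>L\<close> establishes \<open>(w, v) \<in> W\<close> and, if \<open>k \<noteq> l\<close>, that \<open>M\<close> establishes
  \<open>(w', v) \<in> W\<close> for its \<open>l\<close>-th witness \<open>w'\<close>. If \<open>k = l\<close>, then \<open>v\<close> is to be protected instead.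
  Proposals are considered once each, in the order of their codes.\<close>

type_synonym proposal = "nat \<times> nat \<times> nat \<times> nat \<times> entry list \<times> entry list"

definition req :: "nat \<Rightarrow> nat" where
  "req s = fst (decode s :: proposal)"

definition wit :: "nat \<Rightarrow> nat" where
  "wit s = prod_encode (req s, fst (snd (decode s :: proposal)))"

definition wit' :: "nat \<Rightarrow> nat" where
  "wit' s = prod_encode (req s, fst (snd (snd (decode s :: proposal))))"

definition target :: "nat \<Rightarrow> nat" where
  "target s = fst (snd (snd (snd (decode s :: proposal))))"

text \<open>Equality of \<open>wit s\<close> and \<open>wit' s\<close> separates the protecting
  ground from the two-witness ground. The condition \<open>target s \<noteq> wit s\<close> keeps a
  proposal from enumerating the number that it protects.\<close>

definition admissible :: "nat \<Rightarrow> bool" where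
  "admissible s \<longleftrightarrow>
    halts (snd (prod_decode (req s))) (prod_encode (wit s, target s))
      (fst (snd (snd (snd (snd (decode s :: proposal)))))) \<and>
    (if wit s = wit' s
     then target s \<noteq> wit s \<and>
       req s + req s \<le> fst (prod_decode (target s)) + snd (prod_decode (target s))
     else halts (snd (prod_decode (req s))) (prod_encode (wit' s, target s))
       (snd (snd (snd (snd (snd (decode s :: proposal)))))))"

text \<open>With \<open>r\<close> the earlier proposal, the clauses ensure in turn that a
  requirement acts at most once, that protection by \<open>r\<close> is respected, and that
  \<open>s\<close> protects no number enumerated by \<open>r\<close>.\<close>

definition compatible :: "nat \<Rightarrow> nat \<Rightarrow> bool" where
  "compatible r s \<longleftrightarrow> req r \<noteq> req s \<and> (wit r = wit' r \<longrightarrow> target r \<noteq> wit s) \<and>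
    (wit s = wit' s \<longrightarrow> wit r \<noteq> target s)"

primrec accepted_before :: "nat \<Rightarrow> nat list" where
  "accepted_before 0 = []"
| "accepted_before (Suc s) =
    (if admissible s \<and> (\<forall>r\<in>set (accepted_before s). compatible r s)
     then s # accepted_before s else accepted_before s)"

definition accepted :: "nat \<Rightarrow> bool" where
  "accepted s \<longleftrightarrow> s \<in> set (accepted_before (Suc s))"

definition diagonal_set :: "nat set" where
  "diagonal_set = wit ` Collect accepted"

section \<open>Acceptance and what it guarantees\<close>

lemma set_accepted_before: "set (accepted_before s) = {r. r < s \<and> accepted r}"
proof (induction s)
  case (Suc s)
  have "s \<notin> set (accepted_before s)" using Suc by simp
  then have "accepted s \<longleftrightarrow> admissible s \<and> (\<forall>r\<in>set (accepted_before s). compatible r s)"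
    unfolding accepted_def by simp
  with Suc show ?case by (auto simp: less_Suc_eq)
qed simp

lemma accepted_iff:
  "accepted s \<longleftrightarrow> admissible s \<and> (\<forall>r<s. accepted r \<longrightarrow> compatible r s)"
proof -
  have "s \<notin> set (accepted_before s)" by (simp add: set_accepted_before)
  then have "accepted s \<longleftrightarrow> admissible s \<and> (\<forall>r\<in>set (accepted_before s). compatible r s)"
    unfolding accepted_def by simp
  then show ?thesis by (auto simp: set_accepted_before)
qed

lemma computable_wit: "computable wit"
  unfolding wit_def[abs_def] req_def by (intro computable_intros)

text \<open>The accepted proposals below a stage form a list computed by primitive recursion with
  decidable tests. With \<open>diagonal_set_iff\<close> this makes the diagonal set r.e.\<close>

lemma decidable_accepted: "decidable accepted"
proof -
  have w: "computable req" "computable wit'" "computable target"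
    unfolding req_def[abs_def] wit'_def[abs_def] target_def[abs_def] by (intro computable_intros)+
  note c = w[THEN computable_compose] computable_wit[THEN computable_compose]
  have a: "decidable admissible"
    unfolding admissible_def[abs_def] by (intro computable_intros c)
  have b: "decidable (\<lambda>p. compatible (fst p) (snd p))"
    unfolding compatible_def by (intro computable_intros c)
  have eq: "accepted_before s = rec_nat []
      (\<lambda>s l. if admissible s \<and> (\<forall>r\<in>set l. compatible r s) then s # l else l) s" for s
    by (induction s) simp_all
  have l: "computable accepted_before"
    unfolding eq[abs_def]
    by (intro computable_intros decidable_compose[OF a]
        decidable_compose[OF b, where f="\<lambda>p. (snd p, fst (snd (fst p)))", simplified])
  show ?thesis
    unfolding accepted_def[abs_def] by (intro computable_intros computable_compose[OF l])
qed

lemma diagonal_set_iff: "w \<in> diagonal_set \<longleftrightarrow> (\<exists>s. accepted s \<and> wit s = w)"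
  unfolding diagonal_set_def by auto

text \<open>The later of the two proposals was tested against the earlier.\<close>

lemma accepted_compatible:
  assumes "accepted r" "accepted s" "r \<noteq> s" shows "compatible r s \<or> compatible s r"
  using assms by (metis accepted_iff linorder_neqE_nat)

lemma accepted_req_inj: "accepted r \<Longrightarrow> accepted s \<Longrightarrow> req r = req s \<Longrightarrow> r = s"
  using accepted_compatible[of r s] unfolding compatible_def by auto

text \<open>An earlier enumeration of the target is excluded by the last clause of
  \<open>compatible\<close>, a later one by the middle clause, and one by \<open>s\<close> itself by
  \<open>admissible\<close>.\<close>

lemma target_notin_diagonal_set:
  assumes "accepted s" "wit s = wit' s" shows "target s \<notin> diagonal_set"
proof
  assume "target s \<in> diagonal_set"
  then obtain r where r: "accepted r" "wit r = target s" by (auto simp: diagonal_set_iff)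
  have "admissible s" using assms(1) accepted_iff by blast
  with assms(2) r have "r \<noteq> s" by (auto simp: admissible_def)
  from accepted_compatible[OF r(1) assms(1) this] show False
    using r(2) assms(2) unfolding compatible_def by auto
qed

section \<open>Witnesses left unprotected\<close>

definition protected :: "nat set" where
  "protected = {target s | s. accepted s \<and> wit s = wit' s}"

text \<open>Requirement \<open>j\<close> protects at most one number, and none below the \<open>2 * j\<close>-th diagonal.\<close>

lemma infinite_unprotected: "infinite {k. prod_encode (i, k) \<notin> protected}"
proof
  assume fin: "finite {k. prod_encode (i, k) \<notin> protected}" (is "finite ?U")
  \<comment> \<open>The counting below gives K \<le> (i + K) div 2 + 1 + \<open>card ?U\<close>; for
    this \<open>K\<close> the right-hand side is i + 2 * \<open>card ?U\<close> + 3, one too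
    small.\<close>
  define K where "K = i + 2 * card ?U + 4"
  define P where "P = {k. k < K \<and> prod_encode (i, k) \<in> protected}"
  have "\<forall>k\<in>P. \<exists>s. accepted s \<and> wit s = wit' s \<and> target s = prod_encode (i, k)"
    unfolding P_def protected_def by auto
  from bchoice[OF this] obtain f where f: "\<And>k. k \<in> P \<Longrightarrow>
      accepted (f k) \<and> wit (f k) = wit' (f k) \<and> target (f k) = prod_encode (i, k)"
    by blast
  have "inj_on (req \<circ> f) P"
  proof (rule inj_onI)
    fix k l assume kl: "k \<in> P" "l \<in> P" and "(req \<circ> f) k = (req \<circ> f) l"
    then have eq: "f k = f l"
      using f[OF kl(1)] f[OF kl(2)] by (intro accepted_req_inj[of "f k" "f l"]) simp_all
    have "prod_encode (i, k) = target (f k)" using f[OF kl(1)] by simp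
    also have "\<dots> = target (f l)" by (simp only: eq)
    also have "\<dots> = prod_encode (i, l)" using f[OF kl(2)] by simp
    finally show "k = l" by simp
  qed
  \<comment> \<open>The target \<open>prod_encode (i, k)\<close> lies on diagonal i + k, which is at
    least twice the requirement protecting it.\<close>
  moreover have "(req \<circ> f) ` P \<subseteq> {..(i + K) div 2}"
  proof clarify
    fix k assume k: "k \<in> P"
    from f[OF k] have "admissible (f k)" using accepted_iff by blast
    with f[OF k] have "req (f k) + req (f k) \<le> i + k" by (simp add: admissible_def)
    moreover have "k < K" using k by (simp add: P_def)
    ultimately show "(req \<circ> f) k \<le> (i + K) div 2" unfolding o_apply by linarith
  qed
  ultimately have "card P \<le> (i + K) div 2 + 1"
    using card_inj_on_le[of "req \<circ> f" P "{..(i + K) div 2}"] by simp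
  moreover have "{..<K} \<subseteq> P \<union> ?U" by (auto simp: P_def)
  then have "K \<le> card (P \<union> ?U)" using card_mono[of "P \<union> ?U" "{..<K}"] fin by (simp add: P_def)
  then have "K \<le> card P + card ?U" using card_Un_le[of P ?U] by linarith
  ultimately show False unfolding K_def by linarith
qed

text \<open>\<open>W\<close> is the relation that a reduction induces. If the requirement for
  \<open>n\<close> and an index of \<open>W\<close> acts, \<open>reduces\<close> fails; if it never
  acts, its unprotected witnesses are too many.\<close>

lemma diagonal_set_diagonalizes:
  assumes "W \<in> re_sets"
    and total: "\<And>w. column w = n \<Longrightarrow> w \<notin> diagonal_set \<Longrightarrow> \<exists>v. prod_encode (w, v) \<in> W"
    and reduces: "\<And>w v. column w = n \<Longrightarrow> prod_encode (w, v) \<in> W \<Longrightarrow>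
      v \<noteq> w \<and> (w \<in> diagonal_set \<longleftrightarrow> v \<in> diagonal_set)"
  shows False
proof -
  obtain e where W: "W = {z. \<exists>L. halts e z L}" using assms(1) by (rule re_sets_halts)
  define i where "i = prod_encode (n, e)"
  have col: "column (prod_encode (i, k)) = n" for k by (simp add: column_def i_def)
  \<comment> \<open>An accepted \<open>s\<close> puts \<open>wit s\<close> and, by
    \<open>reduces\<close>, its target into the set. So the target is not protected; hence the
    second witness is distinct, related to the target, and in the set as well, against one action
    per requirement.\<close>
  have idle: "req s \<noteq> i" if s: "accepted s" for s
  proof
    assume i: "req s = i"
    have adm: "admissible s" using s accepted_iff by blast
    have "prod_encode (wit s, target s) \<in> W"
      using adm i by (auto simp: admissible_def W i_def)
    moreover have "wit s \<in> diagonal_set" using s by (auto simp: diagonal_set_iff)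
    moreover have cw: "column (wit s) = n" "column (wit' s) = n"
      by (simp_all add: wit_def wit'_def i col)
    ultimately have tgt: "target s \<in> diagonal_set" using reduces by blast
    with s have ne: "wit s \<noteq> wit' s" using target_notin_diagonal_set by blast
    with adm i have "prod_encode (wit' s, target s) \<in> W"
      by (auto simp: admissible_def W i_def)
    with cw tgt have "wit' s \<in> diagonal_set" using reduces by blast
    then obtain r where r: "accepted r" "wit r = wit' s" by (auto simp: diagonal_set_iff)
    then have "req r = req s" by (simp add: wit_def wit'_def)
    with r s have "r = s" by (blast intro: accepted_req_inj)
    with r ne show False by simp
  qed
  have out: "prod_encode (i, k) \<notin> diagonal_set" for k
    using idle by (auto simp: diagonal_set_iff wit_def)
  with total col have "\<exists>v L. halts e (prod_encode (prod_encode (i, k), v)) L" for k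
    unfolding W by blast
  then obtain v D where D: "\<And>k. halts e (prod_encode (prod_encode (i, k), v k)) (D k)" by metis
  have v: "v k \<noteq> prod_encode (i, k)" "v k \<notin> diagonal_set" for k
    using reduces[OF col, of k "v k"] out[of k] D[of k] by (auto simp: W)
  let ?U = "{k. prod_encode (i, k) \<notin> protected}"
  \<comment> \<open>A proposal for an unprotected witness is compatible with every accepted one, as
    \<open>i\<close> never acts and \<open>v k\<close> lies outside the set. So admissibility would
    mean acceptance.\<close>
  have blocked: "\<not> admissible (code (i, k, l, v k, D k, D l))"
    if "k \<in> ?U" for k l
  proof
    define s where "s = code (i, k, l, v k, D k, D l)"
    have dec: "decode s = (i, k, l, v k, D k, D l)" by (simp only: s_def decode_code)
    have s: "req s = i" "wit s = prod_encode (i, k)" "target s = v k"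
      by (simp_all add: req_def wit_def target_def dec)
    assume "admissible (code (i, k, l, v k, D k, D l))"
    moreover have "compatible r s" if "accepted r" for r
      unfolding compatible_def
    proof (intro conjI impI)
      show "req r \<noteq> req s" using idle[OF that] s by simp
      show "target r \<noteq> wit s" if "wit r = wit' r"
        using \<open>accepted r\<close> that \<open>k \<in> ?U\<close> s by (auto simp: protected_def)
      show "wit r \<noteq> target s" using v(2)[of k] that s by (auto simp: diagonal_set_iff)
    qed
    ultimately have "accepted s" using accepted_iff[of s] by (simp add: s_def del: code_pair)
    with idle s show False by blast
  qed
  \<comment> \<open>Two witnesses with a common value would supply the two-witness ground.\<close>
  have "inj_on v ?U"
  proof (rule inj_onI, rule ccontr)
    fix k l assume "k \<in> ?U" "v k = v l" "k \<noteq> l"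
    with D[of k] D[of l] blocked[of k l] show False
      by (simp add: admissible_def req_def wit_def wit'_def target_def i_def del: code_pair)
  qed
  then have "infinite (v ` ?U)" using infinite_unprotected[of i] by (simp add: finite_image_iff)
  \<comment> \<open>With l = k only the bound on the diagonal can fail, since \<open>D k\<close> and
    the choice of \<open>v k\<close> provide the rest of \<open>admissible\<close>.\<close>
  moreover have "v k \<in> prod_encode ` ({..2 * i} \<times> {..2 * i})" if "k \<in> ?U" for k
  proof -
    have "\<not> 2 * i \<le> fst (prod_decode (v k)) + snd (prod_decode (v k))"
      using blocked[OF that, of k] D[of k] v(1)[of k]
      by (auto simp: admissible_def req_def wit_def wit'_def target_def i_def mult_2 simp del: code_pair)
    then have "prod_decode (v k) \<in> {..2 * i} \<times> {..2 * i}" by (auto simp: mem_Times_iff)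
    from imageI[OF this, of prod_encode] show ?thesis by simp
  qed
  then have "v ` ?U \<subseteq> prod_encode ` ({..2 * i} \<times> {..2 * i})" by blast
  then have "finite (v ` ?U)" by (rule finite_subset) simp
  ultimately show False by blast
qed

text \<open>If the set were empty, the graph of the successor function would satisfy the hypotheses
  of \<open>diagonal_set_diagonalizes\<close>. An element serves \<open>embed_True_mono\<close> as a
  first entry that leads out of \<open>embed True Y\<close>.\<close>

lemma diagonal_set_nonempty: obtains c where "c \<in> diagonal_set"
proof -
  let ?R = "\<lambda>z (t::nat). snd (prod_decode z) = Suc (fst (prod_decode z))"
  have "{z. \<exists>t. ?R z t} \<in> re_sets" by (intro re_setsI computable_intros)
  then have "diagonal_set \<noteq> {}"
    using diagonal_set_diagonalizes[of "{z. \<exists>t. ?R z t}" 0] by auto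
  then show ?thesis using that by blast
qed

section \<open>Reductions and degrees\<close>

lemma length_restr [simp]: "length (restr x n) = n"
  by (simp add: restr_def)

lemma nth_restr [simp]: "i < n \<Longrightarrow> restr x n ! i = x i"
  by (simp add: restr_def)

lemma restr_0 [simp]: "restr x 0 = []"
  by (simp add: restr_def)

lemma restr_eq_Nil_iff [simp]: "restr x n = [] \<longleftrightarrow> n = 0"
  by (simp add: restr_def)

lemma restr_Suc: "restr x (Suc n) = x 0 # restr (\<lambda>k. x (Suc k)) n"
  unfolding restr_def by (simp add: map_upt_Suc del: upt_Suc)

lemma restr_append: "restr x (m + n) = restr x m @ restr (\<lambda>k. x (m + k)) n"
  by (rule nth_equalityI) (auto simp: nth_append)

lemma obtain_restr: obtains x where "s = restr x (length s)"
proof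
  show "s = restr ((!) s) (length s)" by (rule nth_equalityI) auto
qed

lemma filterlim_at_top_natD:
  fixes g :: "nat \<Rightarrow> nat"
  assumes "filterlim g at_top sequentially" shows "\<exists>n. i < g n"
proof -
  from assms have "\<forall>\<^sub>F n in sequentially. Suc i \<le> g n" by (simp only: filterlim_at_top)
  then obtain N where "\<And>n. n \<ge> N \<Longrightarrow> Suc i \<le> g n" unfolding eventually_sequentially by blast
  from this[of N] show ?thesis by (intro exI[of _ N]) simp
qed

text \<open>The graph condition becomes one on initial segments. Lengths tending to infinity ensure
  that the union of the finite graphs reaches every position.\<close>

lemma approximates_iff:
  "approximates \<phi> f \<longleftrightarrow>
     (\<forall>s t. prefix s t \<longrightarrow> prefix (\<phi> s) (\<phi> t)) \<and>
     (\<forall>x. filterlim (\<lambda>n. length (\<phi> (restr x n))) at_top sequentially) \<and>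
     (\<forall>x n. \<phi> (restr x n) = restr (f x) (length (\<phi> (restr x n))))"
proof -
  have graph: "{(i, f x i) | i. True} =
      (\<Union>n. {(i, \<phi> (restr x n) ! i) | i. i < length (\<phi> (restr x n))}) \<longleftrightarrow>
      (\<forall>n. \<phi> (restr x n) = restr (f x) (length (\<phi> (restr x n))))" (is "?G = ?U \<longleftrightarrow> ?R")
    if lim: "filterlim (\<lambda>n. length (\<phi> (restr x n))) at_top sequentially" for x
  proof
    assume eq: "?G = ?U"
    show ?R
    proof (intro allI nth_equalityI)
      fix n i assume i: "i < length (\<phi> (restr x n))"
      then have "(i, \<phi> (restr x n) ! i) \<in> ?U" by blast
      then have "(i, \<phi> (restr x n) ! i) \<in> ?G" by (simp only: eq)
      with i show "\<phi> (restr x n) ! i = restr (f x) (length (\<phi> (restr x n))) ! i" by simp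
    qed simp
  next
    assume R: ?R
    have nth: "\<phi> (restr x n) ! i = f x i" if i: "i < length (\<phi> (restr x n))" for n i
    proof -
      have "\<phi> (restr x n) ! i = restr (f x) (length (\<phi> (restr x n))) ! i"
        by (rule arg_cong[of _ _ "\<lambda>l. l ! i", OF R[rule_format]])
      with i show ?thesis by simp
    qed
    show "?G = ?U"
    proof (intro set_eqI iffI)
      fix p assume "p \<in> ?G"
      then obtain i where p: "p = (i, f x i)" by blast
      obtain n where n: "i < length (\<phi> (restr x n))" using filterlim_at_top_natD[OF lim] by blast
      have "p = (i, \<phi> (restr x n) ! i)" unfolding p nth[OF n] ..
      with n show "p \<in> ?U" by blast
    next
      fix p assume "p \<in> ?U"
      then obtain n i where "i < length (\<phi> (restr x n))" "p = (i, \<phi> (restr x n) ! i)" by blast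
      then have "p = (i, f x i)" by (simp only: nth)
      then show "p \<in> ?G" by blast
    qed
  qed
  show ?thesis
    unfolding approximates_def
    by (rule conj_cong[OF refl], rule conj_cong[OF refl], rule all_cong1, rule graph, erule spec)
qed

lemma approximatesD:
  assumes "approximates \<phi> f"
  shows approximates_mono: "prefix s t \<Longrightarrow> prefix (\<phi> s) (\<phi> t)"
    and approximates_filterlim: "filterlim (\<lambda>n. length (\<phi> (restr x n))) at_top sequentially"
    and approximates_restr: "\<phi> (restr x n) = restr (f x) (length (\<phi> (restr x n)))"
proof -
  note * = assms[unfolded approximates_iff]
  show "prefix s t \<Longrightarrow> prefix (\<phi> s) (\<phi> t)"
    by (rule *[THEN conjunct1, rule_format])
  show "filterlim (\<lambda>n. length (\<phi> (restr x n))) at_top sequentially"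
    by (rule *[THEN conjunct2, THEN conjunct1, rule_format])
  show "\<phi> (restr x n) = restr (f x) (length (\<phi> (restr x n)))"
    by (rule *[THEN conjunct2, THEN conjunct2, rule_format])
qed

lemma Comp_iff: "f \<in> Comp \<longleftrightarrow> (\<exists>\<phi>. computable \<phi> \<and> approximates \<phi> f)"
  by (simp add: Comp_def computable_on_strings_iff)

text \<open>For length-preserving approximations. Every string is an initial segment of a sequence,
  and those of \<open>f x\<close> are nested, which yields monotonicity.\<close>

lemma CompI:
  assumes "computable \<phi>" "\<And>x n. \<phi> (restr x n) = restr (f x) n"
  shows "f \<in> Comp"
proof -
  have "prefix (\<phi> s) (\<phi> t)" if "prefix s t" for s t
  proof -
    from that obtain u where t: "t = s @ u" by (auto simp: prefix_def)
    obtain x where "t = restr x (length t)" by (rule obtain_restr)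
    with t have x: "s @ u = restr x (length s) @ restr (\<lambda>k. x (length s + k)) (length u)"
      by (simp add: restr_append)
    then have "s = restr x (length s)" by simp
    with x t assms(2) show ?thesis
      by (metis length_append restr_append prefixI length_restr)
  qed
  moreover have "filterlim (\<lambda>n. length (\<phi> (restr x n))) at_top sequentially" for x
    by (simp add: assms(2) filterlim_ident)
  ultimately show ?thesis
    using assms unfolding Comp_iff approximates_iff by (intro exI[of _ \<phi>]) auto
qed

lemma Comp_compose:
  assumes "f \<in> Comp" "g \<in> Comp" shows "g \<circ> f \<in> Comp"
proof -
  from assms obtain \<phi> \<gamma>
    where \<phi>: "computable \<phi>" "approximates \<phi> f" and \<gamma>: "computable \<gamma>" "approximates \<gamma> g"
    unfolding Comp_iff by blast
  have restr: "\<gamma> (\<phi> (restr x n)) = \<gamma> (restr (f x) (length (\<phi> (restr x n))))" for x n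
    by (rule arg_cong[of _ _ \<gamma>, OF approximates_restr[OF \<phi>(2)]])
  have "filterlim (\<lambda>n. length (\<gamma> (\<phi> (restr x n)))) at_top sequentially" for x
    unfolding restr
    by (rule filterlim_compose[OF approximates_filterlim[OF \<gamma>(2)] approximates_filterlim[OF \<phi>(2)]])
  moreover have "\<gamma> (\<phi> (restr x n)) = restr (g (f x)) (length (\<gamma> (\<phi> (restr x n))))" for x n
    unfolding restr by (rule approximates_restr[OF \<gamma>(2)])
  moreover have "prefix (\<gamma> (\<phi> s)) (\<gamma> (\<phi> t))" if "prefix s t" for s t
    using that by (intro approximates_mono[OF \<gamma>(2)] approximates_mono[OF \<phi>(2)])
  ultimately show ?thesis
    using computable_compose[OF \<gamma>(1) \<phi>(1)] unfolding Comp_iff approximates_iff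
    by (intro exI[of _ "\<lambda>s. \<gamma> (\<phi> s)"]) simp
qed

section \<open>The preorder and its degrees\<close>

lemma comp_le_refl: "A \<le>\<^sub>C A"
proof -
  have "(\<lambda>x. x) \<in> Comp" by (rule CompI[OF computable_id]) simp
  then show ?thesis unfolding comp_le_def by (intro bexI[of _ "\<lambda>x. x"]) auto
qed

lemma comp_le_trans: "A \<le>\<^sub>C B \<Longrightarrow> B \<le>\<^sub>C C \<Longrightarrow> A \<le>\<^sub>C C"
  unfolding comp_le_def by (metis Comp_compose vimage_comp)

text \<open>By transitivity any representatives decide the order of two degrees. Injectivity comes
  from antisymmetry of inclusion.\<close>

lemma order_embedding_comp_degree:
  assumes "\<And>X. X \<in> P \<Longrightarrow> \<psi> X \<in> \<Gamma>"
    and iff: "\<And>X Y. X \<in> P \<Longrightarrow> Y \<in> P \<Longrightarrow> X \<subseteq> Y \<longleftrightarrow> \<psi> X \<le>\<^sub>C \<psi> Y"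
  shows "order_embedding (\<lambda>X. comp_degree (\<psi> X)) P (\<subseteq>) (Deg \<Gamma>) degree_le"
proof -
  have self: "A \<in> comp_degree A" for A
    by (simp add: comp_degree_def comp_equiv_def comp_le_refl)
  have le: "degree_le (comp_degree A) (comp_degree B) \<longleftrightarrow> A \<le>\<^sub>C B" for A B
  proof
    assume "degree_le (comp_degree A) (comp_degree B)"
    then show "A \<le>\<^sub>C B"
      unfolding degree_le_def comp_degree_def comp_equiv_def by (blast intro: comp_le_trans)
  qed (use self in \<open>auto simp: degree_le_def\<close>)
  have "inj_on (\<lambda>X. comp_degree (\<psi> X)) P"
  proof (rule inj_onI)
    fix X Y assume P: "X \<in> P" "Y \<in> P" and "comp_degree (\<psi> X) = comp_degree (\<psi> Y)"
    with self have "\<psi> Y \<in> comp_degree (\<psi> X)" by blast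
    then show "X = Y" using P iff by (auto simp: comp_degree_def comp_equiv_def)
  qed
  then show ?thesis
    using assms(1) iff le unfolding order_embedding_def Deg_def by auto
qed

text \<open>The case \<open>b = True\<close> serves recursive \<open>X\<close>, the case \<open>b = False\<close> recursively enumerable \<open>X\<close>.\<close>

definition embed :: "bool \<Rightarrow> nat set \<Rightarrow> baire set" where
  "embed b X = {x. x 0 \<notin> diagonal_set \<and> column (x 0) \<in> X \<and> (b \<or> (\<exists>k. x (Suc k) \<noteq> 0))}"

section \<open>Reductions induced by inclusion\<close>

lemma computable_column [computable_intros]:
  "computable f \<Longrightarrow> computable (\<lambda>x. column (f x))"
  unfolding column_def by (intro computable_intros)

text \<open>A sequence whose column is outside \<open>X\<close> gets the first entry
  \<open>c\<close> from the diagonal set and so leaves \<open>embed True Y\<close>; the others stay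
  unchanged, their column being in \<open>Y\<close>.\<close>

lemma embed_True_mono:
  assumes "decidable (\<lambda>n. n \<in> X)" "X \<subseteq> Y" shows "embed True X \<le>\<^sub>C embed True Y"
proof -
  obtain c where c: "c \<in> diagonal_set" by (rule diagonal_set_nonempty)
  let ?h = "\<lambda>a. if column a \<in> X then a else c"
  let ?\<phi> = "\<lambda>s. case s of [] \<Rightarrow> [] | a # t \<Rightarrow> ?h a # t"
  have "(\<lambda>x. x(0 := ?h (x 0))) \<in> Comp"
  proof (rule CompI)
    show "computable ?\<phi>" by (intro computable_intros decidable_compose[OF assms(1)])
    show "?\<phi> (restr x n) = restr (x(0 := ?h (x 0))) n" for x n
      by (cases n) (auto simp: restr_Suc)
  qed
  moreover have "embed True X = (\<lambda>x. x(0 := ?h (x 0))) -` embed True Y"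
    using c assms(2) by (auto simp: embed_def)
  ultimately show ?thesis unfolding comp_le_def by blast
qed

text \<open>The first entry is kept. For k coding (j, t), output position \<open>Suc k\<close>
  copies the input at \<open>Suc j\<close> if \<open>t\<close> witnesses that the column is in
  \<open>X\<close>, and is 0 otherwise. So a nonzero entry appears after the first iff the column is
  in \<open>X\<close> and the input has such an entry.\<close>

lemma embed_False_mono:
  assumes "X \<in> re_sets" "X \<subseteq> Y" shows "embed False X \<le>\<^sub>C embed False Y"
proof -
  obtain R :: "nat \<Rightarrow> entry list \<Rightarrow> bool"
    where R: "decidable (\<lambda>p. R (fst p) (snd p))" and X: "X = {n. \<exists>t. R n t}"
    using assms(1) by (rule re_sets_decidable)
  let ?g = "\<lambda>a (y::baire) k. if R (column a) (decode (snd (prod_decode k)))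
      then y (fst (prod_decode k)) else 0"
  let ?f = "\<lambda>x k. case k of 0 \<Rightarrow> x 0 | Suc k \<Rightarrow> ?g (x 0) (\<lambda>k. x (Suc k)) k"
  let ?\<phi> = "\<lambda>s. case s of [] \<Rightarrow> [] | a # t \<Rightarrow> a # map (?g a (nth0 t)) [0..<length t]"
  have "?f \<in> Comp"
  proof (rule CompI)
    show "computable ?\<phi>"
      by (intro computable_intros decidable_compose[OF R,
            where f="\<lambda>p. (column (f p), g p)" for f g, simplified])
    \<comment> \<open>The first component of a pair is at most its code, so a prefix of the input
      determines an output prefix of the same length.\<close>
    have "fst (prod_decode k) < n" if "k < n" for k n
      using le_prod_encode_1[of "fst (prod_decode k)" "snd (prod_decode k)"] that by simp
    then have "map (?g a (nth0 (restr y n))) [0..<n] = restr (?g a y) n" for a y n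
      unfolding restr_def[of "?g a y"] by (auto simp: nth0_eq)
    then show "?\<phi> (restr x n) = restr (?f x) n" for x n
      by (cases n) (simp_all add: restr_Suc)
  qed
  moreover have "embed False X = ?f -` embed False Y"
  proof (intro set_eqI iffI)
    fix x assume "x \<in> embed False X"
    then obtain t k where x: "x 0 \<notin> diagonal_set" "column (x 0) \<in> Y" "R (column (x 0)) t" "x (Suc k) \<noteq> 0"
      using assms(2) by (auto simp: embed_def X)
    then have "?f x (Suc (prod_encode (k, code t))) \<noteq> 0" by simp
    then have "\<exists>k. ?f x (Suc k) \<noteq> 0" by (rule exI)
    then have "?f x \<in> embed False Y"
      unfolding embed_def mem_Collect_eq using x(1,2) by (intro conjI disjI2) simp_all
    then show "x \<in> ?f -` embed False Y" by (simp only: vimage_eq)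
  next
    fix x assume "x \<in> ?f -` embed False Y"
    then show "x \<in> embed False X" by (auto simp: embed_def X split: if_splits)
  qed
  ultimately show ?thesis unfolding comp_le_def by blast
qed

lemma embed_reflects:
  assumes "embed b X \<le>\<^sub>C embed b Y" "Y \<in> re_sets" shows "X \<subseteq> Y"
proof (rule subsetI, rule ccontr)
  fix n assume n: "n \<in> X" "n \<notin> Y"
  from assms(1) obtain f where "f \<in> Comp" and f: "embed b X = f -` embed b Y"
    unfolding comp_le_def by blast
  from \<open>f \<in> Comp\<close> obtain \<phi> where \<phi>: "computable \<phi>" "approximates \<phi> f"
    unfolding Comp_iff by blast
  obtain R :: "nat \<Rightarrow> entry list \<Rightarrow> bool"
    where R: "decidable (\<lambda>p. R (fst p) (snd p))" and Y: "Y = {n. \<exists>t. R n t}"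
    using assms(2) by (rule re_sets_decidable)
  \<comment> \<open>The entries 1 satisfy the clause for \<open>b = False\<close>, so membership of
    \<open>x w\<close> in \<open>embed b X\<close> depends on \<open>w\<close> alone.\<close>
  define x :: "nat \<Rightarrow> baire" where "x w = (\<lambda>k. if k = 0 then w else 1)" for w
  \<comment> \<open>The certificate \<open>t\<close> holds the length of an input prefix, a position
    and a witness that the column of \<open>v\<close> is in \<open>Y\<close>. The length test guards
    against the default 0 of \<open>nth0\<close>, which could pass for an output beginning with 0;
    it cannot pass the nonzero test.\<close>
  define Q where "Q z t \<longleftrightarrow>
      0 < length (\<phi> (restr (x (fst (prod_decode z))) (fst t))) \<and>
      nth0 (\<phi> (restr (x (fst (prod_decode z))) (fst t))) 0 = snd (prod_decode z) \<and>
      R (column (snd (prod_decode z))) (snd (snd t)) \<and>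
      (b \<or> nth0 (\<phi> (restr (x (fst (prod_decode z))) (fst t))) (Suc (fst (snd t))) \<noteq> 0)"
    for z and t :: "nat \<times> nat \<times> entry list"
  have "decidable (\<lambda>p. Q (fst p) (snd p))"
    unfolding Q_def x_def restr_def
    by (intro computable_intros computable_compose[OF \<phi>(1)]
        decidable_compose[OF R, where f="\<lambda>p. (column (f p), g p)" for f g, simplified])
  then have "{z. \<exists>t. Q z t} \<in> re_sets" by (rule re_setsI)
  moreover have Q: "(\<exists>t. Q (prod_encode (w, v)) t) \<longleftrightarrow>
      f (x w) 0 = v \<and> column v \<in> Y \<and> (b \<or> (\<exists>k. f (x w) (Suc k) \<noteq> 0))" for w v
  proof -
    have len: "\<exists>m. i < length (\<phi> (restr (x w) m))" for i
      by (rule filterlim_at_top_natD[OF approximates_filterlim[OF \<phi>(2)]])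
    have nth: "nth0 (\<phi> (restr (x w) m)) i =
        (if i < length (\<phi> (restr (x w) m)) then f (x w) i else 0)" for m i
      by (subst approximates_restr[OF \<phi>(2)]) (simp add: nth0_eq)
    show ?thesis
    proof
      assume "\<exists>t. Q (prod_encode (w, v)) t"
      then show "f (x w) 0 = v \<and> column v \<in> Y \<and> (b \<or> (\<exists>k. f (x w) (Suc k) \<noteq> 0))"
        by (auto simp: Q_def Y nth split: if_splits)
    next
      assume *: "f (x w) 0 = v \<and> column v \<in> Y \<and> (b \<or> (\<exists>k. f (x w) (Suc k) \<noteq> 0))"
      then obtain k d where kd: "R (column v) d" "b \<or> f (x w) (Suc k) \<noteq> 0" by (auto simp: Y)
      obtain m where "Suc k < length (\<phi> (restr (x w) m))" using len by blast
      with * kd have "Q (prod_encode (w, v)) (m, k, d)" by (auto simp: Q_def nth)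
      then show "\<exists>t. Q (prod_encode (w, v)) t" ..
    qed
  qed
  have x: "w \<notin> diagonal_set \<longleftrightarrow> f (x w) \<in> embed b Y" if "column w = n" for w
  proof -
    have "x w \<in> embed b X \<longleftrightarrow> w \<notin> diagonal_set" using n that by (simp add: embed_def x_def)
    then show ?thesis using f by auto
  qed
  from calculation show False
  proof (rule diagonal_set_diagonalizes[where n = n])
    show "\<exists>v. prod_encode (w, v) \<in> {z. \<exists>t. Q z t}" if "column w = n" "w \<notin> diagonal_set" for w
      unfolding mem_Collect_eq Q using x[OF that(1)] that(2) by (auto simp: embed_def)
    \<comment> \<open>The column of \<open>v\<close> is in \<open>Y\<close> and that of
      \<open>w\<close> is \<open>n\<close>, so they differ. The remaining clauses of
      \<open>embed b Y\<close> hold for \<open>f (x w)\<close>, so membership there means that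
      \<open>v\<close> is outside the diagonal set.\<close>
    show "v \<noteq> w \<and> (w \<in> diagonal_set \<longleftrightarrow> v \<in> diagonal_set)"
      if "column w = n" "prod_encode (w, v) \<in> {z. \<exists>t. Q z t}" for w v
      using x[OF that(1)] that n unfolding mem_Collect_eq Q by (auto simp: embed_def)
  qed
qed

section \<open>Complexity of the embedded sets\<close>

lemma recursive_sets_iff: "X \<in> recursive_sets \<longleftrightarrow> decidable (\<lambda>n. n \<in> X)"
  by (simp only: recursive_sets_def decidable_def computable_nat_iff mem_Collect_eq)

lemma recursive_sets_re_sets:
  assumes "X \<in> recursive_sets" shows "X \<in> re_sets"
proof -
  have "{n. \<exists>t::nat. n \<in> X} \<in> re_sets"
    by (intro re_setsI decidable_compose[OF assms[unfolded recursive_sets_iff]] computable_intros)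
  then show ?thesis by simp
qed

text \<open>Membership depends on the first entry alone, and its failure is r.e., as
  \<open>X\<close> is decidable and the diagonal set r.e.\<close>

lemma embed_True_Pi01:
  assumes "X \<in> recursive_sets" shows "embed True X \<in> Pi01"
proof -
  have X: "decidable (\<lambda>n. n \<in> X)" using assms by (simp only: recursive_sets_iff)
  let ?W = "{[a] | a. a \<in> diagonal_set \<or> column a \<notin> X}"
  let ?R = "\<lambda>z (t::nat \<times> nat). z = code [fst t] \<and>
      (accepted (snd t) \<and> wit (snd t) = fst t \<or> column (fst t) \<notin> X)"
  have "{z. \<exists>t. ?R z t} \<in> re_sets"
    by (intro re_setsI computable_intros decidable_compose[OF decidable_accepted]
        decidable_compose[OF X] computable_compose[OF computable_wit])
  moreover have "{z. \<exists>t. ?R z t} = list_encode ` ?W"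
    by (auto simp: code_nat_list diagonal_set_iff image_Collect simp del: list_encode.simps)
  moreover have "- embed True X = (\<Union>s\<in>?W. cylinder s)"
    by (auto simp: embed_def cylinder_def restr_Suc)
  ultimately show ?thesis unfolding Pi01_def Sigma01_def by auto
qed

text \<open>The number \<open>m\<close> codes a witness that the column is in \<open>X\<close> and a
  position of a nonzero entry. For fixed \<open>m\<close> both are checked on finitely many entries,
  and avoiding the r.e. diagonal set is a \<Pi>01 condition.\<close>

lemma embed_False_Sigma02:
  assumes "X \<in> re_sets" shows "embed False X \<in> Sigma02"
proof -
  obtain R :: "nat \<Rightarrow> entry list \<Rightarrow> bool"
    where R: "decidable (\<lambda>p. R (fst p) (snd p))" and X: "X = {n. \<exists>t. R n t}"
    using assms by (rule re_sets_decidable)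
  define P where "P = {(m, x). x 0 \<notin> diagonal_set \<and>
      R (column (x 0)) (decode (fst (prod_decode m))) \<and> x (Suc (snd (prod_decode m))) \<noteq> 0}"
  \<comment> \<open>For k the second component of \<open>m\<close>, length k + 2 lets
    \<open>s\<close> reach the tested positions 0 and k + 1.\<close>
  define Q where "Q m s t \<longleftrightarrow> length s = Suc (Suc (snd (prod_decode m))) \<and>
      (accepted t \<and> wit t = nth0 s 0 \<or> \<not> R (column (nth0 s 0)) (decode (fst (prod_decode m))) \<or>
       nth0 s (Suc (snd (prod_decode m))) = 0)" for m s t
  let ?W = "{(m, s). \<exists>t. Q m s t}"
  have "decidable (\<lambda>p. Q (fst (prod_decode (fst p))) (decode (snd (prod_decode (fst p)))) (snd p))"
    unfolding Q_def
    by (intro computable_intros decidable_compose[OF decidable_accepted]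
        computable_compose[OF computable_wit]
        decidable_compose[OF R, where f="\<lambda>p. (column (f p), g p)" for f g, simplified])
  then have "{z. \<exists>t. Q (fst (prod_decode z)) (decode (snd (prod_decode z))) t} \<in> re_sets"
    by (intro re_setsI) simp
  moreover have "{z. \<exists>t. Q (fst (prod_decode z)) (decode (snd (prod_decode z))) t} =
      (\<lambda>(m, s). prod_encode (m, list_encode s)) ` ?W"
  proof (intro set_eqI iffI)
    fix z assume z: "z \<in> {z. \<exists>t. Q (fst (prod_decode z)) (decode (snd (prod_decode z))) t}"
    have "z = prod_encode (fst (prod_decode z), list_encode (decode (snd (prod_decode z))))"
      by (simp add: code_nat_list[symmetric])
    with z show "z \<in> (\<lambda>(m, s). prod_encode (m, list_encode s)) ` ?W"
      by (intro image_eqI[of _ _ "(fst (prod_decode z), decode (snd (prod_decode z)))"]) auto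
  qed (auto simp: code_nat_list[symmetric])
  moreover have "- P = (\<Union>(m, s)\<in>?W. {m} \<times> cylinder s)"
  proof (intro set_eqI iffI)
    fix p assume p: "p \<in> - P"
    obtain m x where mx: "p = (m, x)" by (cases p)
    with p have "(m, restr x (Suc (Suc (snd (prod_decode m))))) \<in> ?W"
      by (auto simp: P_def Q_def nth0_eq diagonal_set_iff)
    then show "p \<in> (\<Union>(m, s)\<in>?W. {m} \<times> cylinder s)"
      unfolding mx by (intro UN_I) (auto simp: cylinder_def)
  next
    fix p assume "p \<in> (\<Union>(m, s)\<in>?W. {m} \<times> cylinder s)"
    then obtain m s t x where p: "p = (m, x)" "Q m s t" "restr x (length s) = s"
      by (auto simp: cylinder_def)
    then have "nth0 s i = x i" if "i < length s" for i
      using that by (metis nth0_eq nth_restr)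
    with p show "p \<in> - P" by (auto simp: P_def Q_def diagonal_set_iff)
  qed
  ultimately have "- P \<in> Sigma01_prod" unfolding Sigma01_prod_def by auto
  moreover have "embed False X = {x. \<exists>m. (m, x) \<in> P}"
  proof (intro set_eqI iffI)
    fix x assume "x \<in> embed False X"
    then obtain t k where "x 0 \<notin> diagonal_set" "R (column (x 0)) t" "x (Suc k) \<noteq> 0"
      by (auto simp: embed_def X)
    then have "(prod_encode (code t, k), x) \<in> P" by (simp add: P_def)
    then show "x \<in> {x. \<exists>m. (m, x) \<in> P}" by blast
  qed (auto simp: embed_def X P_def)
  ultimately show ?thesis unfolding Sigma02_def Pi01_prod_def by blast
qed

theorem theorem3p2:
  shows "(\<exists>\<psi>\<^sub>0 :: nat set \<Rightarrow> baire set.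
            (\<forall>X\<in>recursive_sets. \<psi>\<^sub>0 X \<in> Pi01) \<and>
            (\<forall>X\<in>recursive_sets. \<forall>Y\<in>recursive_sets. X \<subseteq> Y \<longleftrightarrow> \<psi>\<^sub>0 X \<le>\<^sub>C \<psi>\<^sub>0 Y) \<and>
            order_embedding (\<lambda>X. comp_degree (\<psi>\<^sub>0 X)) recursive_sets (\<subseteq>) (Deg Pi01) degree_le)
       \<and> (\<exists>\<psi>\<^sub>1 :: nat set \<Rightarrow> baire set.
            (\<forall>X\<in>re_sets. \<psi>\<^sub>1 X \<in> Sigma02) \<and>
            (\<forall>X\<in>re_sets. \<forall>Y\<in>re_sets. X \<subseteq> Y \<longleftrightarrow> \<psi>\<^sub>1 X \<le>\<^sub>C \<psi>\<^sub>1 Y) \<and>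
            order_embedding (\<lambda>X. comp_degree (\<psi>\<^sub>1 X)) re_sets (\<subseteq>) (Deg Sigma02) degree_le)"
proof (intro conjI exI ballI)
  fix X Y assume "X \<in> recursive_sets" "Y \<in> recursive_sets"
  then show "X \<subseteq> Y \<longleftrightarrow> embed True X \<le>\<^sub>C embed True Y"
    using embed_True_mono embed_reflects recursive_sets_iff recursive_sets_re_sets by blast
next
  fix X Y assume "X \<in> re_sets" "Y \<in> re_sets"
  then show "X \<subseteq> Y \<longleftrightarrow> embed False X \<le>\<^sub>C embed False Y"
    using embed_False_mono embed_reflects by blast
next
  show "order_embedding (\<lambda>X. comp_degree (embed True X)) recursive_sets (\<subseteq>) (Deg Pi01) degree_le"
    using embed_True_mono embed_reflects recursive_sets_iff recursive_sets_re_sets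
    by (intro order_embedding_comp_degree embed_True_Pi01) blast+
  show "order_embedding (\<lambda>X. comp_degree (embed False X)) re_sets (\<subseteq>) (Deg Sigma02) degree_le"
    using embed_False_mono embed_reflects
    by (intro order_embedding_comp_degree embed_False_Sigma02) blast+
qed (rule embed_True_Pi01 embed_False_Sigma02; assumption)+

end
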